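(* Let $G$ be a topological group, $X$ a separable metrizable space and $\alpha:G\times X\to X$ a continuous $d$-open action. Then there exist a countable metrizable topological group $H$, a metrizable compactification $bX$ of $X$ and a continuous action $\gamma:H\times bX\to bX$, under which $X$ is invariant, such that the restriction $\gamma|_{H\times X}:H\times X\to X$ is a $d$-open action. Moreover, for any countable subset $S\subset G$, the group $H$ can be constructed in such a way that $S\subset H$, in the sense that for every $s\in S$ the homeomorphism $x\mapsto\alpha(s,x)$ of $X$ is of the form $x\mapsto\gamma(h,x)$ for some $h\in H$.
   Context: All spaces (including topological groups) are Tychonoff. A continuous action of a topological group $G$ on $X$ is $d$-open if $x\in\mathrm{int}(\mathrm{cl}(Ox))$ (closure and interior in $X$) for every $x\in X$ and every open neighborhood $O$ of the unit $e\in G$. "Countable" means finite or countably infinite. *)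

theory Defs
  imports "HOL-Analysis.Analysis" "HOL-Algebra.Group_Action"
begin

(* HOL-Algebra.Congruence uses closure_of as a prefix operator on generalised objects; it is
   removed here so that closure_of always means the topological closure. *)
no_notation eq_closure_of ("closure'_of\<index>")

definition tychonoff_space :: "'a topology \<Rightarrow> bool"
  where "tychonoff_space X \<longleftrightarrow> completely_regular_space X \<and> Hausdorff_space X"

(* Not necessarily Hausdorff: separation is assumed separately through tychonoff_space. *)
locale topological_group = group G for G (structure) +
  fixes T :: "'a topology"
  assumes topspace_eq_carrier: "topspace T = carrier G"
    and continuous_mult: "continuous_map (prod_topology T T) T (\<lambda>(g, h). g \<otimes> h)"
    and continuous_inv: "continuous_map T T (\<lambda>g. inv g)"

(* The library's group_action asks for maps that are extensional on the underlying set. The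
   restriction below makes the values of \<alpha> g outside of topspace X irrelevant, so that the same
   \<alpha> can be viewed as an action on a space and on its invariant subspaces. *)
definition continuous_action ::
    "('g, 'm) monoid_scheme \<Rightarrow> 'g topology \<Rightarrow> 'x topology \<Rightarrow> ('g \<Rightarrow> 'x \<Rightarrow> 'x) \<Rightarrow> bool"
  where "continuous_action G T X \<alpha> \<longleftrightarrow>
    group_action G (topspace X) (\<lambda>g. restrict (\<alpha> g) (topspace X)) \<and>
    continuous_map (prod_topology T X) X (\<lambda>(g, x). \<alpha> g x)"

definition d_open_action ::
    "('g, 'm) monoid_scheme \<Rightarrow> 'g topology \<Rightarrow> 'x topology \<Rightarrow> ('g \<Rightarrow> 'x \<Rightarrow> 'x) \<Rightarrow> bool"
  where "d_open_action G T X \<alpha> \<longleftrightarrow>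
    continuous_action G T X \<alpha> \<and>
    (\<forall>x \<in> topspace X. \<forall>U. openin T U \<and> \<one>\<^bsub>G\<^esub> \<in> U \<longrightarrow>
       x \<in> X interior_of (X closure_of ((\<lambda>g. \<alpha> g x) ` U)))"

(* A compactification of X is given by an embedding e of X onto a dense subspace of a compact
   Hausdorff space B; the image of e plays the role of X as a subspace of B. *)
definition compactification :: "'x topology \<Rightarrow> ('x \<Rightarrow> 'b) \<Rightarrow> 'b topology \<Rightarrow> bool"
  where "compactification X e B \<longleftrightarrow>
    compact_space B \<and> Hausdorff_space B \<and>
    embedding_map X B e \<and> B closure_of (e ` topspace X) = topspace B"

end

theory Submission
  imports Defs
begin

text \<open>
  The group \<open>H\<close> is a countable group of homeomorphisms of \<open>X\<close> that come from \<open>G\<close>, with the topology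
  of uniform convergence on a metrizable compactification of \<open>X\<close>. For the action of \<open>H\<close> to inherit
  \<open>d\<close>-openness from \<open>G\<close>, every uniform neighbourhood of the identity must contain the translations by
  a neighbourhood of the unit of \<open>G\<close>. The compactification therefore has to be generated by functions
  \<open>f\<close> that are uniform for the action: \<open>f (g x)\<close> tends to \<open>f x\<close> uniformly in \<open>x\<close> as \<open>g\<close> tends to the
  unit.

  Such functions exist in abundance because the action is \<open>d\<close>-open. Call a set \<open>P\<close> well inside \<open>Q\<close> if the
  closure of \<open>V P\<close> lies in \<open>Q\<close> for some neighbourhood \<open>V\<close> of the unit. Square roots of neighbourhoods
  show that one can interpolate in this relation, and \<open>d\<close>-openness shows that it implies that the
  closure of \<open>P\<close> lies in the interior of \<open>Q\<close>
  (\<open>well_inside_closure_interior\<close>). Urysohn's construction along the dyadic rationals then yields a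
  continuous function, and as each of the finitely many steps of a given dyadic mesh has its own
  \<open>V\<close>, this function is uniform for the action (\<open>action_uniform_scale\<close>). As \<open>X\<close> is
  second countable, countably many of these functions, forming a set \<open>F\<close>, determine its topology.

  The countable subgroup \<open>A\<close> of \<open>G\<close> must be so rich that small elements of \<open>G\<close> can be replaced by small
  elements of \<open>A\<close>: whenever some \<open>g\<close> that moves finitely many of the functions \<open>f \<circ> h\<close>, with \<open>f\<close> in \<open>F\<close>
  and \<open>h\<close> in \<open>A\<close>, by at most \<open>1 / (n + 1)\<close> maps a basic open set \<open>V\<close> into a basic open set \<open>W\<close>, then \<open>A\<close>
  contains an element that does both. Since the condition refers to \<open>A\<close> itself, \<open>A\<close> is obtained by
  closing \<open>S\<close> under countably many finitary operations (\<open>countable_d_open_subgroup\<close>). At every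
  point of \<open>X\<close>, the orbit of the small part of \<open>A\<close> then has in its closure the orbit of a whole
  neighbourhood of the unit of \<open>G\<close>, so that \<open>d\<close>-openness passes to \<open>A\<close>.

  The functions \<open>f \<circ> h\<close> embed \<open>X\<close> in the cube \<open>[0,1]\<^sup>\<nat>\<close>, and the compactification is the closure of
  the image. Composition with an element of \<open>A\<close> only reindexes these functions, so \<open>A\<close> acts on the closure
  by reindexing coordinates; this also makes the uniform topology a group topology. It is
  metrizable after elements that act alike on \<open>X\<close> are identified.
\<close>

section \<open>Functions that are uniform for a d-open action\<close>

context topological_group
begin

lemma symmetric_neighbourhood:
  assumes "openin T V" "\<one> \<in> V"
  obtains W where "openin T W" "\<one> \<in> W" "W \<subseteq> V" "\<And>g. g \<in> W \<Longrightarrow> inv g \<in> W"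
proof
  let ?W = "V \<inter> {g \<in> topspace T. inv g \<in> V}"
  show "openin T ?W"
    using assms continuous_inv by (intro openin_Int openin_continuous_map_preimage) auto
  show "\<one> \<in> ?W" "?W \<subseteq> V"
    using assms topspace_eq_carrier by auto
  show "inv g \<in> ?W" if "g \<in> ?W" for g
    using that topspace_eq_carrier by auto
qed

lemma square_root_neighbourhood:
  assumes "openin T V" "\<one> \<in> V"
  obtains W where "openin T W" "\<one> \<in> W" "\<And>g h. \<lbrakk>g \<in> W; h \<in> W\<rbrakk> \<Longrightarrow> g \<otimes> h \<in> V"
proof -
  let ?P = "{p \<in> topspace (prod_topology T T). (\<lambda>(g, h). g \<otimes> h) p \<in> V}"
  have "openin (prod_topology T T) ?P"
    using continuous_mult assms(1) by (rule openin_continuous_map_preimage)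
  moreover have "(\<one>, \<one>) \<in> ?P"
    using assms topspace_eq_carrier by auto
  ultimately have "\<exists>W1 W2. openin T W1 \<and> openin T W2 \<and> \<one> \<in> W1 \<and> \<one> \<in> W2 \<and> W1 \<times> W2 \<subseteq> ?P"
    by (rule openin_prod_topology_alt[THEN iffD1, rule_format])
  then obtain W1 W2 where W: "openin T W1" "openin T W2" "\<one> \<in> W1" "\<one> \<in> W2" "W1 \<times> W2 \<subseteq> ?P"
    by (elim exE conjE)
  show ?thesis
    by (rule that[of "W1 \<inter> W2"]) (use W in auto)
qed

end

locale d_open_transformation_group = topological_group G T for G (structure) and T +
  fixes X :: "'x topology" and \<alpha> :: "'a \<Rightarrow> 'x \<Rightarrow> 'x"
  assumes d_open: "d_open_action G T X \<alpha>"
begin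

lemma action: "group_action G (topspace X) (\<lambda>g. restrict (\<alpha> g) (topspace X))"
  using d_open by (simp add: d_open_action_def continuous_action_def)

lemma act_closed [simp, intro]: "\<lbrakk>g \<in> carrier G; x \<in> topspace X\<rbrakk> \<Longrightarrow> \<alpha> g x \<in> topspace X"
  using group_action.element_image[OF action, of g x] by force

lemma act_one [simp]: "x \<in> topspace X \<Longrightarrow> \<alpha> \<one> x = x"
  using fun_cong[OF group_action.id_eq_one[OF action], of x] by simp

lemma act_mult: "\<lbrakk>g \<in> carrier G; h \<in> carrier G; x \<in> topspace X\<rbrakk> \<Longrightarrow> \<alpha> (g \<otimes> h) x = \<alpha> g (\<alpha> h x)"
  using group_action.composition_rule[OF action, of x g h] by simp

lemma act_inv_act: "\<lbrakk>g \<in> carrier G; x \<in> topspace X\<rbrakk> \<Longrightarrow> \<alpha> (inv g) (\<alpha> g x) = x"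
  by (simp flip: act_mult)

lemma continuous_act: "continuous_map (prod_topology T X) X (\<lambda>(g, x). \<alpha> g x)"
  using d_open by (simp add: d_open_action_def continuous_action_def)

lemma continuous_translation:
  assumes "g \<in> carrier G"
  shows "continuous_map X X (\<alpha> g)"
proof -
  have "continuous_map X (prod_topology T X) (\<lambda>x. (g, x))"
    using assms topspace_eq_carrier by (auto intro!: continuous_map_pairedI)
  from continuous_map_compose[OF this continuous_act] show ?thesis
    by (simp add: o_def)
qed

lemma continuous_orbit_map:
  assumes "x \<in> topspace X"
  shows "continuous_map T X (\<lambda>g. \<alpha> g x)"
proof -
  have "continuous_map T (prod_topology T X) (\<lambda>g. (g, x))"
    using assms by (auto intro!: continuous_map_pairedI)
  from continuous_map_compose[OF this continuous_act] show ?thesis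
    by (simp add: o_def)
qed

lemma translate_closure_subset:
  "g \<in> carrier G \<Longrightarrow> \<alpha> g ` (X closure_of A) \<subseteq> X closure_of (\<alpha> g ` A)"
  by (intro continuous_map_image_closure_subset continuous_translation)

lemma d_openD:
  "\<lbrakk>x \<in> topspace X; openin T U; \<one> \<in> U\<rbrakk> \<Longrightarrow> x \<in> X interior_of (X closure_of ((\<lambda>g. \<alpha> g x) ` U))"
  using d_open by (simp add: d_open_action_def)

text \<open>The analogue, for the uniformity that the action induces on \<open>X\<close>, of one set being a uniform
  neighbourhood of another one: the closure is built in because \<open>d\<close>-openness controls only
  closures of orbits.\<close>

definition well_inside :: "'x set \<Rightarrow> 'x set \<Rightarrow> bool"
  where "well_inside A B \<longleftrightarrow> A \<subseteq> topspace X \<and> B \<subseteq> topspace X \<and>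
    (\<exists>V. openin T V \<and> \<one> \<in> V \<and> X closure_of (\<Union>g\<in>V. \<alpha> g ` A) \<subseteq> B)"

lemma subset_translates: "\<lbrakk>\<one> \<in> V; A \<subseteq> topspace X\<rbrakk> \<Longrightarrow> A \<subseteq> (\<Union>g\<in>V. \<alpha> g ` A)"
  by (force simp: image_iff)

lemma translates_subset_topspace:
  "\<lbrakk>openin T V; A \<subseteq> topspace X\<rbrakk> \<Longrightarrow> (\<Union>g\<in>V. \<alpha> g ` A) \<subseteq> topspace X"
  using openin_subset topspace_eq_carrier by blast

lemma well_inside_translates:
  assumes "well_inside A B"
  obtains V where "openin T V" "\<one> \<in> V" "\<And>g x. \<lbrakk>g \<in> V; x \<in> A\<rbrakk> \<Longrightarrow> \<alpha> g x \<in> B"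
proof -
  obtain V where V: "openin T V" "\<one> \<in> V" "X closure_of (\<Union>g\<in>V. \<alpha> g ` A) \<subseteq> B" "A \<subseteq> topspace X"
    using assms by (auto simp: well_inside_def)
  then have "(\<Union>g\<in>V. \<alpha> g ` A) \<subseteq> B"
    by (metis closure_of_subset subset_trans translates_subset_topspace)
  then show thesis
    by (intro that[OF V(1,2)]) auto
qed

lemma well_inside_subset:
  assumes "well_inside A B"
  shows "A \<subseteq> B"
  using assms by (metis act_one subset_iff well_inside_def well_inside_translates)

lemma well_inside_trans:
  assumes AB: "well_inside A B" and BC: "well_inside B C"
  shows "well_inside A C"
proof -
  obtain V where V: "openin T V" "\<one> \<in> V" "X closure_of (\<Union>g\<in>V. \<alpha> g ` B) \<subseteq> C"
    using BC by (auto simp: well_inside_def)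
  have "X closure_of (\<Union>g\<in>V. \<alpha> g ` A) \<subseteq> X closure_of (\<Union>g\<in>V. \<alpha> g ` B)"
    using well_inside_subset[OF AB] by (intro closure_of_mono) blast
  then show ?thesis
    using V AB BC unfolding well_inside_def by blast
qed

text \<open>If \<open>W\<close> is a square root of the neighbourhood that separates \<open>A\<close> from \<open>B\<close>, then the closure
  of \<open>W A\<close> lies halfway: translating it by \<open>W\<close> again stays in the closure of \<open>V A\<close>, as
  translations are continuous.\<close>

lemma well_inside_interpolate:
  assumes "well_inside A B"
  obtains C where "well_inside A C" "well_inside C B"
proof -
  obtain V where V: "openin T V" "\<one> \<in> V" "X closure_of (\<Union>g\<in>V. \<alpha> g ` A) \<subseteq> B"
    and A: "A \<subseteq> topspace X" and B: "B \<subseteq> topspace X"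
    using assms by (auto simp: well_inside_def)
  obtain W where W: "openin T W" "\<one> \<in> W" "\<And>g h. \<lbrakk>g \<in> W; h \<in> W\<rbrakk> \<Longrightarrow> g \<otimes> h \<in> V"
    using square_root_neighbourhood[OF V(1,2)] by metis
  have WG: "W \<subseteq> carrier G"
    using W(1) openin_subset topspace_eq_carrier by blast
  define C where "C = X closure_of (\<Union>g\<in>W. \<alpha> g ` A)"
  have C: "C \<subseteq> topspace X"
    by (simp add: C_def closure_of_subset_topspace)
  have "\<alpha> g ` C \<subseteq> X closure_of (\<Union>g\<in>V. \<alpha> g ` A)" if "g \<in> W" for g
  proof -
    have "\<alpha> g ` (\<Union>h\<in>W. \<alpha> h ` A) \<subseteq> (\<Union>g\<in>V. \<alpha> g ` A)"
    proof clarsimp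
      fix h x assume "h \<in> W" "x \<in> A"
      then have "\<alpha> g (\<alpha> h x) = \<alpha> (g \<otimes> h) x"
        using that WG A by (simp add: act_mult subset_iff)
      then show "\<exists>k\<in>V. \<alpha> g (\<alpha> h x) \<in> \<alpha> k ` A"
        using W(3)[OF that \<open>h \<in> W\<close>] \<open>x \<in> A\<close> by auto
    qed
    then have "X closure_of (\<alpha> g ` (\<Union>h\<in>W. \<alpha> h ` A)) \<subseteq> X closure_of (\<Union>g\<in>V. \<alpha> g ` A)"
      by (rule closure_of_mono)
    then show ?thesis
      using translate_closure_subset that WG unfolding C_def by blast
  qed
  then have "X closure_of (\<Union>g\<in>W. \<alpha> g ` C) \<subseteq> X closure_of (\<Union>g\<in>V. \<alpha> g ` A)"
    by (intro closure_of_minimal) auto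
  then have "well_inside C B"
    using V W B C unfolding well_inside_def by blast
  moreover have "well_inside A C"
    using A C W unfolding well_inside_def C_def by blast
  ultimately show thesis
    using that by blast
qed

text \<open>The only place where the uniform functions need \<open>d\<close>-openness: for a point \<open>y\<close> in the closure
  of \<open>A\<close>, the orbit piece \<open>V y\<close> lies in the closure of \<open>V A\<close>, hence so does the closure of \<open>V y\<close>,
  and that is a neighbourhood of \<open>y\<close>.\<close>

lemma well_inside_closure_interior:
  assumes "well_inside A B"
  shows "X closure_of A \<subseteq> X interior_of B"
proof
  fix y assume y: "y \<in> X closure_of A"
  then have yX: "y \<in> topspace X"
    using closure_of_subset_topspace[of X A] by blast
  obtain V where V: "openin T V" "\<one> \<in> V" "X closure_of (\<Union>g\<in>V. \<alpha> g ` A) \<subseteq> B"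
    using assms by (auto simp: well_inside_def)
  have "(\<lambda>g. \<alpha> g y) ` V \<subseteq> X closure_of (\<Union>g\<in>V. \<alpha> g ` A)"
  proof clarify
    fix g assume g: "g \<in> V"
    then have "\<alpha> g y \<in> X closure_of (\<alpha> g ` A)"
      using translate_closure_subset y V(1) openin_subset topspace_eq_carrier by blast
    moreover have "X closure_of (\<alpha> g ` A) \<subseteq> X closure_of (\<Union>g\<in>V. \<alpha> g ` A)"
      using g by (intro closure_of_mono) blast
    ultimately show "\<alpha> g y \<in> X closure_of (\<Union>g\<in>V. \<alpha> g ` A)" by blast
  qed
  then have "X closure_of ((\<lambda>g. \<alpha> g y) ` V) \<subseteq> B"
    using V(3) by (metis closedin_closure_of closure_of_minimal subset_trans)
  then show "y \<in> X interior_of B"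
    using d_openD[OF yX V(1,2)] interior_of_mono by blast
qed

text \<open>Known as \<open>\<alpha>\<close>-uniform functions. As coordinates of a compactification they ensure that
  translations by elements near the unit are close to the identity uniformly on \<open>X\<close>.\<close>

definition action_uniform :: "('x \<Rightarrow> real) \<Rightarrow> bool"
  where "action_uniform f \<longleftrightarrow> continuous_map X euclideanreal f \<and> f ` topspace X \<subseteq> {0..1} \<and>
    (\<forall>\<epsilon>>0. \<exists>V. openin T V \<and> \<one> \<in> V \<and> (\<forall>g\<in>V. \<forall>x\<in>topspace X. \<bar>f (\<alpha> g x) - f x\<bar> \<le> \<epsilon>))"

end

lemma dyadic_between:
  fixes a b :: real
  assumes "0 \<le> a" "a < b" "b \<le> 1"
  obtains r where "r \<in> dyadics \<inter> {0..1}" "a < r" "r < b"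
proof -
  obtain n where n: "1 / 2 ^ n < b - a"
    using real_arch_pow_inv[of "b - a" "1/2"] assms by (auto simp: power_one_over)
  define k where "k = nat \<lfloor>a * 2 ^ n\<rfloor> + 1"
  have k: "a * 2 ^ n < real k" "real k \<le> a * 2 ^ n + 1"
    using assms by (auto simp: k_def) linarith+
  show thesis
  proof
    show lo: "a < real k / 2 ^ n"
      using k by (simp add: field_simps)
    have "real k / 2 ^ n \<le> a + 1 / 2 ^ n"
      using k by (simp add: field_simps)
    then show hi: "real k / 2 ^ n < b"
      using n by linarith
    show "real k / 2 ^ n \<in> dyadics \<inter> {0..1}"
    proof (rule IntI)
      show "real k / 2 ^ n \<in> dyadics"
        by (auto simp: dyadics_def)
      show "real k / 2 ^ n \<in> {0..1}"
        unfolding atLeastAtMost_iff using lo hi assms by linarith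
    qed
  qed
qed

context d_open_transformation_group
begin

lemma action_uniform_neighbourhood:
  assumes "action_uniform f" "\<epsilon> > 0"
  obtains V where "openin T V" "\<one> \<in> V"
    "\<And>g x. \<lbrakk>g \<in> V; x \<in> topspace X\<rbrakk> \<Longrightarrow> \<bar>f (\<alpha> g x) - f x\<bar> \<le> \<epsilon>"
proof -
  have "\<exists>V. openin T V \<and> \<one> \<in> V \<and> (\<forall>g\<in>V. \<forall>x\<in>topspace X. \<bar>f (\<alpha> g x) - f x\<bar> \<le> \<epsilon>)"
    using assms by (simp add: action_uniform_def)
  then show thesis
    by (elim exE conjE) (simp add: that)
qed

text \<open>Urysohn's lemma for the relation \<open>well_inside\<close>. The level sets at dyadic levels are nested,
  which gives continuity by \<open>well_inside_closure_interior\<close>. Uniformity holds since a neighbourhood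
  of the unit that shifts every level of the mesh into the next one changes the function by at
  most two mesh widths.\<close>

lemma action_uniform_scale:
  assumes "well_inside A0 A1"
  obtains f where "action_uniform f" "\<And>x. x \<in> A0 \<Longrightarrow> f x = 0" "\<And>x. x \<notin> A1 \<Longrightarrow> f x = 1"
proof -
  let ?D = "dyadics \<inter> {0..1::real}"
  have "\<exists>A :: real \<Rightarrow> 'x set. A 0 = A0 \<and> A 1 = A1 \<and>
      (\<forall>r \<in> ?D. \<forall>s \<in> ?D. r < s \<longrightarrow> well_inside (A r) (A s))"
  proof (rule recursion_on_dyadic_fractions)
    show "\<exists>z. well_inside x z \<and> well_inside z y" if "well_inside x y" for x y
      using that by (meson well_inside_interpolate)
  qed (use assms well_inside_trans in blast)+
  then obtain A :: "real \<Rightarrow> 'x set" where A: "A 0 = A0" "A 1 = A1"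
    and inside: "\<And>r s. \<lbrakk>r \<in> ?D; s \<in> ?D; r < s\<rbrakk> \<Longrightarrow> well_inside (A r) (A s)"
    by blast
  have D01: "0 \<in> ?D" "1 \<in> ?D"
    using real_in_dyadics[of 0] real_in_dyadics[of 1] by auto
  have mono: "A r \<subseteq> A s" if "r \<in> ?D" "s \<in> ?D" "r \<le> s" for r s
    using inside[of r s] well_inside_subset[of "A r" "A s"] that by (cases "r = s") auto
  have "A 1 \<subseteq> topspace X"
    using assms A unfolding well_inside_def by blast
  then have AX: "A r \<subseteq> topspace X" if "r \<in> ?D" for r
    using mono[OF that D01(2)] that by auto
  define f where "f x = Inf (insert 1 {r \<in> ?D. x \<in> A r})" for x
  have bdd: "bdd_below (insert 1 {r \<in> ?D. x \<in> A r})" for x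
    by (intro bdd_belowI[of _ 0]) auto
  have f_le1: "f x \<le> 1" for x
    unfolding f_def by (intro cInf_lower bdd) auto
  have f_ge0: "0 \<le> f x" for x
    unfolding f_def by (intro cInf_greatest) auto
  have f_le: "f x \<le> r" if "r \<in> ?D" "x \<in> A r" for r x
    unfolding f_def using that by (intro cInf_lower bdd) auto
  have less_f: "x \<in> A r" if r: "r \<in> ?D" and "f x < r" for r x
  proof -
    have "\<exists>s\<in>insert 1 {r \<in> ?D. x \<in> A r}. s < r"
      using \<open>f x < r\<close> unfolding f_def by (intro cInf_lessD) simp_all
    then obtain s where s: "s \<in> insert 1 {r \<in> ?D. x \<in> A r}" "s < r"
      by (elim bexE)
    then have "s \<in> ?D" "x \<in> A s"
      using r by auto
    then show ?thesis
      using mono[of s r] r s by auto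
  qed
  have "f x = 0" if "x \<in> A0" for x
    using f_le[OF D01(1), of x] f_ge0[of x] that A by simp
  moreover have "f x = 1" if "x \<notin> A1" for x
    using less_f[OF D01(2), of x] f_le1[of x] that A by fastforce
  moreover have "action_uniform f"
    unfolding action_uniform_def
  proof (intro conjI allI impI)
    show "continuous_map X euclideanreal f"
      unfolding continuous_map_upper_lower_semicontinuous_lt
    proof (intro conjI allI; subst openin_subopen; clarify)
      fix a x assume x: "x \<in> topspace X" "a < f x"
      show "\<exists>U. openin X U \<and> x \<in> U \<and> U \<subseteq> {y \<in> topspace X. a < f y}"
      proof (cases "a < 0")
        case True
        then have "a < f y" for y
          using f_ge0[of y] by linarith
        then show ?thesis
          using x by (intro exI[of _ "topspace X"]) auto
      next
        case False
        obtain s where s: "s \<in> ?D" "a < s" "s < f x"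
          using dyadic_between[of a "f x"] False x f_le1 by (metis not_less)
        obtain r where r: "r \<in> ?D" "a < r" "r < s"
          using dyadic_between[of a s] False s f_le1[of x] by (metis less_le_trans not_less order_less_imp_le)
        show ?thesis
        proof (intro exI[of _ "topspace X - X closure_of A r"] conjI)
          have "x \<notin> A s"
            using f_le s by fastforce
          moreover have "X closure_of A r \<subseteq> A s"
            using well_inside_closure_interior[OF inside[OF r(1) s(1) r(3)]] interior_of_subset[of X "A s"]
            by (rule subset_trans)
          ultimately show "x \<in> topspace X - X closure_of A r"
            using x by blast
          show "topspace X - X closure_of A r \<subseteq> {y \<in> topspace X. a < f y}"
            proof
            fix y assume y: "y \<in> topspace X - X closure_of A r"
            then have "y \<notin> A r"
              using closure_of_subset[OF AX[OF r(1)]] by blast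
            then have "r \<le> f y"
              using less_f[OF r(1), of y] by (meson not_le)
            then show "y \<in> {y \<in> topspace X. a < f y}"
              using y r(2) by simp
          qed
        qed auto
      qed
    next
      fix a x assume x: "x \<in> topspace X" "f x < a"
      show "\<exists>U. openin X U \<and> x \<in> U \<and> U \<subseteq> {y \<in> topspace X. f y < a}"
      proof (cases "a > 1")
        case True
        then have "f y < a" for y
          using f_le1[of y] by linarith
        then show ?thesis
          using x by (intro exI[of _ "topspace X"]) auto
      next
        case False
        obtain s where s: "s \<in> ?D" "f x < s" "s < a"
          using dyadic_between[of "f x" a] False x f_ge0 by (metis not_less)
        obtain r where r: "r \<in> ?D" "f x < r" "r < s"
          using dyadic_between[of "f x" s] s f_ge0[of x] by auto
        show ?thesis
        proof (intro exI[of _ "X interior_of A s"] conjI)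
          have "x \<in> X closure_of A r"
            using closure_of_subset[OF AX[OF r(1)]] less_f[OF r(1,2)] by (rule subsetD)
          then show "x \<in> X interior_of A s"
            using well_inside_closure_interior[OF inside[OF r(1) s(1) r(3)]] by blast
          show "X interior_of A s \<subseteq> {y \<in> topspace X. f y < a}"
          proof
            fix y assume "y \<in> X interior_of A s"
            then have "y \<in> A s" "y \<in> topspace X"
              using interior_of_subset[of X "A s"] interior_of_subset_topspace[of X "A s"] by blast+
            then show "y \<in> {y \<in> topspace X. f y < a}"
              using f_le[OF s(1), of y] s(3) by simp
          qed
        qed auto
      qed
    qed
    show "f ` topspace X \<subseteq> {0..1}"
      using f_ge0 f_le1 by auto
    fix \<epsilon> :: real assume "\<epsilon> > 0"
    then obtain n where n: "1 / 2 ^ n < \<epsilon> / 2"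
      using real_arch_pow_inv[of "\<epsilon> / 2" "1/2"] by (auto simp: power_one_over)
    have "\<exists>V. openin T V \<and> \<one> \<in> V \<and> (\<forall>g\<in>V. \<forall>x\<in>A (real k / 2 ^ n). \<alpha> g x \<in> A (real (Suc k) / 2 ^ n))"
      if "k < 2 ^ n" for k
    proof -
      have le: "real (Suc k) \<le> 2 ^ n"
        using that by (metis Suc_leI of_nat_le_iff of_nat_numeral of_nat_power)
      have "well_inside (A (real k / 2 ^ n)) (A (real (Suc k) / 2 ^ n))"
        using le by (intro inside) (auto simp: dyadics_def divide_simps simp del: of_nat_Suc)
      then show ?thesis
        by (meson well_inside_translates)
    qed
    then obtain V where V: "\<And>k. k < 2 ^ n \<Longrightarrow> openin T (V k) \<and> \<one> \<in> V k"
      and shift: "\<And>k g x. \<lbrakk>k < 2 ^ n; g \<in> V k; x \<in> A (real k / 2 ^ n)\<rbrakk> \<Longrightarrow> \<alpha> g x \<in> A (real (Suc k) / 2 ^ n)"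
      by metis
    have "openin T (\<Inter>k\<in>{..<2 ^ n}. V k)" "\<one> \<in> (\<Inter>k\<in>{..<2 ^ n}. V k)"
      using V by (auto intro!: openin_INT2 simp: lessThan_empty_iff)
    then obtain W where W: "openin T W" "\<one> \<in> W" "W \<subseteq> (\<Inter>k\<in>{..<2 ^ n}. V k)"
      and W_inv: "\<And>g. g \<in> W \<Longrightarrow> inv g \<in> W"
      by (metis symmetric_neighbourhood)
    \<comment> \<open>The level just above \<open>f x\<close> contains \<open>x\<close>, and \<open>g\<close> moves it into the next level; the case
      distinction ensures that both levels are at most \<open>1\<close>.\<close>
    have step: "f (\<alpha> g x) \<le> f x + \<epsilon>" if g: "g \<in> W" for g x
    proof (cases "f x + 2 / 2 ^ n < 1")
      case True
      define k where "k = nat \<lfloor>f x * 2 ^ n\<rfloor> + 1"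
      have k: "f x * 2 ^ n < real k" "real k \<le> f x * 2 ^ n + 1"
        using f_ge0[of x] by (auto simp: k_def) linarith+
      have "f x * 2 ^ n + 2 < 2 ^ n"
        using True by (simp add: field_simps)
      then have k2: "real (Suc k) < 2 ^ n"
        using k by simp
      then have k1: "k < 2 ^ n"
        by (metis Suc_lessD of_nat_less_iff of_nat_numeral of_nat_power)
      have D: "real k / 2 ^ n \<in> ?D" "real (Suc k) / 2 ^ n \<in> ?D"
        using k2 by (auto simp: dyadics_def divide_simps simp del: of_nat_Suc)
      have "x \<in> A (real k / 2 ^ n)"
        using k by (intro less_f D) (simp add: field_simps)
      then have "\<alpha> g x \<in> A (real (Suc k) / 2 ^ n)"
        using W(3) g k1 by (intro shift) auto
      then have "f (\<alpha> g x) \<le> real (Suc k) / 2 ^ n"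
        by (intro f_le D)
      also have "\<dots> \<le> (f x * 2 ^ n + 2) / 2 ^ n"
        using k by (intro divide_right_mono) auto
      also have "\<dots> = f x + 2 * (1 / 2 ^ n)"
        by (simp add: add_divide_distrib)
      finally show ?thesis
        using n by linarith
    next
      case False
      then show ?thesis
        using f_le1[of "\<alpha> g x"] n by simp
    qed
    \<comment> \<open>The reverse estimate is the same one for \<open>inv g\<close> at the point \<open>g x\<close>, so \<open>W\<close> was taken
      symmetric.\<close>
    have "\<bar>f (\<alpha> g x) - f x\<bar> \<le> \<epsilon>" if g: "g \<in> W" and x: "x \<in> topspace X" for g x
    proof -
      have "g \<in> carrier G"
        using W(1) g openin_subset topspace_eq_carrier by blast
      then have "f x \<le> f (\<alpha> g x) + \<epsilon>"
        using step[OF W_inv[OF g], of "\<alpha> g x"] x by (simp add: act_inv_act)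
      with step[OF g, of x] show ?thesis
        by linarith
    qed
    with W show "\<exists>V. openin T V \<and> \<one> \<in> V \<and> (\<forall>g\<in>V. \<forall>x\<in>topspace X. \<bar>f (\<alpha> g x) - f x\<bar> \<le> \<epsilon>)"
      by blast
  qed
  ultimately show thesis
    using that by blast
qed

text \<open>Continuity of the orbit map at the unit puts a point well inside each of its neighbourhoods;
  regularity absorbs the closure in the definition of \<open>well_inside\<close>.\<close>

lemma action_uniform_separation:
  assumes "regular_space X" "openin X U" "x \<in> U"
  obtains f where "action_uniform f" "f x = 0" "\<And>y. y \<in> topspace X - U \<Longrightarrow> f y = 1"
proof -
  obtain W where W: "openin X W" "x \<in> W" "X closure_of W \<subseteq> U"
  proof -
    have "\<exists>W C. openin X W \<and> closedin X C \<and> x \<in> W \<and> W \<subseteq> C \<and> C \<subseteq> U"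
      using assms neighbourhood_base_of[of "closedin X" X] neighbourhood_base_of_closedin[of X] by simp
    then obtain W C where "openin X W" "closedin X C" "x \<in> W" "W \<subseteq> C" "C \<subseteq> U"
      by (elim exE conjE)
    moreover from this have "X closure_of W \<subseteq> C"
      by (intro closure_of_minimal)
    ultimately show thesis
      by (intro that[of W]) auto
  qed
  have xX: "x \<in> topspace X"
    using assms openin_subset by blast
  let ?V = "{g \<in> topspace T. \<alpha> g x \<in> W}"
  have "openin T ?V"
    using continuous_orbit_map[OF xX] W(1) by (rule openin_continuous_map_preimage)
  moreover have "\<one> \<in> ?V"
    using topspace_eq_carrier W xX by simp
  moreover have "X closure_of (\<Union>g\<in>?V. \<alpha> g ` {x}) \<subseteq> X closure_of W"
    by (rule closure_of_mono) auto
  ultimately have "well_inside {x} U"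
    using W(3) xX assms(2) openin_subset unfolding well_inside_def by blast
  then obtain f where "action_uniform f" "f x = 0" "\<And>y. y \<notin> U \<Longrightarrow> f y = 1"
    by (metis action_uniform_scale singletonI)
  then show thesis
    using that by blast
qed

end

section \<open>A countable subgroup with d-open orbits\<close>

lemma separable_metrizable_imp_second_countable:
  assumes "separable_space X" "metrizable_space X"
  shows "second_countable X"
proof -
  obtain M d where M: "Metric_space M d" and X: "X = Metric_space.mtopology M d"
    using assms(2) by (auto simp: metrizable_space_def)
  interpret Metric_space M d by (rule M)
  obtain C where C: "countable C" "C \<subseteq> M" "X closure_of C = M"
    using assms(1) by (auto simp: separable_space_def X)
  let ?B = "(\<lambda>(c, n). mball c (1 / real (Suc n))) ` (C \<times> UNIV)"
  have "\<exists>V\<in>?B. x \<in> V \<and> V \<subseteq> U" if U: "openin X U" "x \<in> U" for U x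
  proof -
    obtain \<epsilon> where "\<epsilon> > 0" and \<epsilon>: "mball x \<epsilon> \<subseteq> U" and xM: "x \<in> M"
      using U openin_mtopology X by (metis subsetD)
    obtain n where n: "1 / real (Suc n) < \<epsilon> / 2"
      using \<open>\<epsilon> > 0\<close> by (metis half_gt_zero inverse_eq_divide reals_Archimedean)
    have "x \<in> X closure_of C"
      using C(3) xM by simp
    then have "\<forall>r>0. \<exists>c\<in>C. c \<in> mball x r"
      by (simp add: X metric_closure_of)
    moreover have "1 / real (Suc n) > 0"
      by simp
    ultimately obtain c where c: "c \<in> C" "c \<in> mball x (1 / real (Suc n))"
      by blast
    have "mball c (1 / real (Suc n)) \<subseteq> mball x \<epsilon>"
    proof
      fix y assume y: "y \<in> mball c (1 / real (Suc n))"
      then have "d x y \<le> d x c + d c y"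
        using c xM by (intro triangle) auto
      then show "y \<in> mball x \<epsilon>"
        using y c n xM by (auto simp del: of_nat_Suc)
    qed
    moreover have "x \<in> mball c (1 / real (Suc n))"
      using c by (auto simp: commute simp del: of_nat_Suc)
    ultimately show ?thesis
      using \<epsilon> c(1) by (intro bexI[of _ "mball c (1 / real (Suc n))"]) auto
  qed
  moreover have "countable ?B"
    using C(1) by auto
  moreover have "\<forall>V\<in>?B. openin X V"
    by (auto simp: X)
  ultimately show ?thesis
    unfolding second_countable_def by (intro exI[of _ ?B]) blast
qed

text \<open>A downward Loewenheim-Skolem principle: only countably many finite lists can be formed at
  each of countably many stages, and every list over the union already appears at some stage.\<close>

lemma countable_closure_under_operations:
  fixes op :: "'j \<Rightarrow> 'a list \<Rightarrow> 'a"
  assumes "countable J" "countable S" "S \<subseteq> C" and closed: "\<And>j l. \<lbrakk>j \<in> J; l \<in> lists C\<rbrakk> \<Longrightarrow> op j l \<in> C"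
  obtains A where "countable A" "S \<subseteq> A" "A \<subseteq> C" "\<And>j l. \<lbrakk>j \<in> J; l \<in> lists A\<rbrakk> \<Longrightarrow> op j l \<in> A"
proof -
  define E where "E = rec_nat S (\<lambda>_ B. B \<union> (\<lambda>(j, l). op j l) ` (J \<times> lists B))"
  have E0: "E 0 = S" and ES: "\<And>n. E (Suc n) = E n \<union> (\<lambda>(j, l). op j l) ` (J \<times> lists (E n))"
    by (simp_all add: E_def)
  have mono: "E m \<subseteq> E n" if "m \<le> n" for m n
    using that by (induction n rule: dec_induct) (auto simp: ES)
  have countable_E: "countable (E n)" for n
    by (induction n) (use assms in \<open>auto simp: E0 ES\<close>)
  have EC: "E n \<subseteq> C" for n
  proof (induction n)
    case (Suc n)
    then have "lists (E n) \<subseteq> lists C"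
      by (rule lists_mono)
    then have "op j l \<in> C" if "j \<in> J" "l \<in> lists (E n)" for j l
      using closed that by blast
    with Suc show ?case
      by (simp add: ES image_subset_iff)
  qed (use assms in \<open>simp add: E0\<close>)
  have list_stage: "\<exists>n. l \<in> lists (E n)" if "l \<in> lists (\<Union>n. E n)" for l
    using that
  proof (induction l)
    case (Cons a l)
    then obtain m n where "a \<in> E m" "l \<in> lists (E n)"
      by auto
    then have "a # l \<in> lists (E (max m n))"
      using mono[of m "max m n"] lists_mono[OF mono[of n "max m n"]] by auto
    then show ?case ..
  qed auto
  show thesis
  proof (rule that[of "\<Union>n. E n"])
    show "op j l \<in> (\<Union>n. E n)" if "j \<in> J" and "l \<in> lists (\<Union>n. E n)" for j l
    proof -
      obtain n where "l \<in> lists (E n)"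
        using list_stage[OF \<open>l \<in> lists _\<close>] by (elim exE)
      then have "op j l \<in> E (Suc n)"
        using that by (force simp: ES)
      then show ?thesis by blast
    qed
    show "S \<subseteq> (\<Union>n. E n)"
      using E0 by blast
  qed (use countable_E EC in auto)
qed

context d_open_transformation_group
begin

text \<open>There may be uncountably many uniform functions, but it suffices to choose one for each pair
  \<open>(U, V)\<close> of basic sets that some function separates, being below \<open>1/2\<close> on \<open>V\<close> and \<open>1\<close> off \<open>U\<close>.
  The gap between \<open>1/2\<close> and \<open>1\<close> leaves room to pass from the zero of a function to a basic set.\<close>

lemma countable_action_uniform_family:
  assumes "second_countable X" "regular_space X"
  obtains F where "countable F" "\<And>f. f \<in> F \<Longrightarrow> action_uniform f"
    "\<And>U x. \<lbrakk>openin X U; x \<in> U\<rbrakk> \<Longrightarrow> \<exists>f\<in>F. f x < 1/2 \<and> (\<forall>y\<in>topspace X - U. f y = 1)"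
proof -
  obtain \<B> where \<B>: "countable \<B>" "\<And>V. V \<in> \<B> \<Longrightarrow> openin X V"
    and base: "\<And>U x. \<lbrakk>openin X U; x \<in> U\<rbrakk> \<Longrightarrow> \<exists>V\<in>\<B>. x \<in> V \<and> V \<subseteq> U"
    using assms(1) unfolding second_countable_def by metis
  define sep where "sep p f \<longleftrightarrow> action_uniform f \<and> (\<forall>y\<in>snd p. f y < 1/2) \<and>
    (\<forall>y\<in>topspace X - fst p. f y = 1)" for p :: "'x set \<times> 'x set" and f
  define P where "P = {p \<in> \<B> \<times> \<B>. \<exists>f. sep p f}"
  define F where "F = (\<lambda>p. SOME f. sep p f) ` P"
  have sep_some: "sep p (SOME f. sep p f)" if "p \<in> P" for p
    using that someI_ex[of "sep p"] by (auto simp: P_def)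
  show thesis
  proof
    have "countable P"
      unfolding P_def using \<B>(1) by (intro countable_subset[OF Collect_restrict] countable_SIGMA)
    then show "countable F"
      by (simp add: F_def)
    show "action_uniform f" if "f \<in> F" for f
      using that sep_some unfolding F_def sep_def by blast
    fix U x assume U: "openin X U" "x \<in> U"
    obtain U' where U': "U' \<in> \<B>" "x \<in> U'" "U' \<subseteq> U"
      using base[OF U] by blast
    obtain f where f: "action_uniform f" "f x = 0" "\<And>y. y \<in> topspace X - U' \<Longrightarrow> f y = 1"
      using action_uniform_separation[OF assms(2) \<B>(2)[OF U'(1)] U'(2)] by metis
    have opn: "openin X {y \<in> topspace X. f y \<in> {..<1/2}}"
      using f(1) unfolding action_uniform_def by (intro openin_continuous_map_preimage) auto
    obtain V where V: "V \<in> \<B>" "x \<in> V" "V \<subseteq> {y \<in> topspace X. f y \<in> {..<1/2}}"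
    proof -
      have "x \<in> {y \<in> topspace X. f y \<in> {..<1/2}}"
        using f(2) U openin_subset[of X U] by auto
      from base[OF opn this] show thesis
        by (elim bexE conjE) (rule that)
    qed
    have "sep (U', V) f"
      using f V by (auto simp: sep_def)
    then have "(U', V) \<in> P"
      using U'(1) V(1) by (auto simp: P_def)
    then obtain k where "sep (U', V) k" "k \<in> F"
      using sep_some by (auto simp: F_def)
    then show "\<exists>f\<in>F. f x < 1/2 \<and> (\<forall>y\<in>topspace X - U. f y = 1)"
      using V(2) U'(3) unfolding sep_def by (intro bexI[of _ k]) auto
  qed
qed

text \<open>Moving \<open>h x\<close> by the conjugate of \<open>g\<close> under \<open>h\<close> is the same as applying \<open>h\<close> to \<open>g x\<close>, and
  conjugation is continuous.\<close>

lemma action_uniform_translate: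
  assumes f: "action_uniform f" and h: "h \<in> carrier G"
  shows "action_uniform (\<lambda>x. f (\<alpha> h x))"
  unfolding action_uniform_def
proof (intro conjI allI impI)
  show "continuous_map X euclideanreal (\<lambda>x. f (\<alpha> h x))"
    using continuous_map_compose[OF continuous_translation[OF h], of euclideanreal f] f
    by (simp add: action_uniform_def o_def)
  show "(\<lambda>x. f (\<alpha> h x)) ` topspace X \<subseteq> {0..1}"
    using f h by (auto simp: action_uniform_def image_subset_iff)
  fix \<epsilon> :: real assume "\<epsilon> > 0"
  then obtain V where V: "openin T V" "\<one> \<in> V"
    and small: "\<And>g x. \<lbrakk>g \<in> V; x \<in> topspace X\<rbrakk> \<Longrightarrow> \<bar>f (\<alpha> g x) - f x\<bar> \<le> \<epsilon>"
    using action_uniform_neighbourhood[OF f] by metis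
  let ?c = "\<lambda>g. h \<otimes> g \<otimes> inv h"
  have left: "continuous_map T T (\<lambda>g. h \<otimes> g)"
    using continuous_map_compose[OF _ continuous_mult, of T "\<lambda>g. (h, g)"] h topspace_eq_carrier
    by (simp add: o_def continuous_map_pairedI)
  have "continuous_map T T ?c"
    using continuous_map_compose[OF _ continuous_mult, of T "\<lambda>g. (h \<otimes> g, inv h)"] h topspace_eq_carrier left
    by (simp add: o_def continuous_map_pairedI)
  then have "openin T {g \<in> topspace T. ?c g \<in> V}"
    using V(1) by (rule openin_continuous_map_preimage)
  moreover have "\<one> \<in> {g \<in> topspace T. ?c g \<in> V}"
    using V h topspace_eq_carrier by simp
  moreover have "\<bar>f (\<alpha> h (\<alpha> g x)) - f (\<alpha> h x)\<bar> \<le> \<epsilon>"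
    if "g \<in> {g \<in> topspace T. ?c g \<in> V}" "x \<in> topspace X" for g x
  proof -
    have g: "g \<in> carrier G" "?c g \<in> V"
      using that topspace_eq_carrier by auto
    have "\<alpha> (?c g) (\<alpha> h x) = \<alpha> (?c g \<otimes> h) x"
      using g h that by (subst act_mult) auto
    also have "?c g \<otimes> h = h \<otimes> g"
      using g h by (simp add: m_assoc)
    finally have "\<alpha> (?c g) (\<alpha> h x) = \<alpha> h (\<alpha> g x)"
      using g h that by (simp add: act_mult)
    then show ?thesis
      using small[OF g(2), of "\<alpha> h x"] h that by simp
  qed
  ultimately show "\<exists>V. openin T V \<and> \<one> \<in> V \<and>
      (\<forall>g\<in>V. \<forall>x\<in>topspace X. \<bar>f (\<alpha> h (\<alpha> g x)) - f (\<alpha> h x)\<bar> \<le> \<epsilon>)"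
    by (intro exI[of _ "{g \<in> topspace T. ?c g \<in> V}"]) blast
qed

definition nearly_fixing :: "('x \<Rightarrow> real) set \<Rightarrow> real \<Rightarrow> 'a set"
  where "nearly_fixing K \<epsilon> = {g \<in> carrier G. \<forall>f\<in>K. \<forall>x\<in>topspace X. \<bar>f (\<alpha> g x) - f x\<bar> \<le> \<epsilon>}"

lemma nearly_fixing_neighbourhood:
  assumes "finite K" "\<And>f. f \<in> K \<Longrightarrow> action_uniform f" "\<epsilon> > 0"
  obtains V where "openin T V" "\<one> \<in> V" "V \<subseteq> nearly_fixing K \<epsilon>"
proof -
  have "\<forall>f\<in>K. \<exists>V. openin T V \<and> \<one> \<in> V \<and> (\<forall>g\<in>V. \<forall>x\<in>topspace X. \<bar>f (\<alpha> g x) - f x\<bar> \<le> \<epsilon>)"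
    using assms(2,3) by (simp add: action_uniform_def)
  then obtain V where V: "\<And>f. f \<in> K \<Longrightarrow> openin T (V f) \<and> \<one> \<in> V f"
    and small: "\<And>f g x. \<lbrakk>f \<in> K; g \<in> V f; x \<in> topspace X\<rbrakk> \<Longrightarrow> \<bar>f (\<alpha> g x) - f x\<bar> \<le> \<epsilon>"
    by metis
  let ?V = "carrier G \<inter> (\<Inter>f\<in>K. V f)"
  have "openin T ?V"
  proof (cases "K = {}")
    case False
    then show ?thesis
      using assms(1) V topspace_eq_carrier by (metis (no_types, lifting) openin_INT2 openin_Int openin_topspace)
  qed (simp flip: topspace_eq_carrier)
  moreover have "\<one> \<in> ?V" "?V \<subseteq> nearly_fixing K \<epsilon>"
    using V small by (auto simp: nearly_fixing_def)
  ultimately show thesis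
    using that by blast
qed

definition translates :: "('x \<Rightarrow> real) set \<Rightarrow> 'a set \<Rightarrow> ('x \<Rightarrow> real) set"
  where "translates F A = (\<lambda>(f, h) x. f (\<alpha> h x)) ` (F \<times> A)"

text \<open>The closure of the orbit of \<open>x\<close> under the elements of \<open>A\<close> that nearly fix \<open>K\<close> contains \<open>O x\<close>
  for some neighbourhood \<open>O\<close> of the unit of \<open>G\<close>. Uncountably many points \<open>x\<close> are treated by
  countably many choices, because \<open>g x\<close> being in \<open>W\<close> is witnessed by a basic set \<open>V\<close> around \<open>x\<close>
  that \<open>g\<close> maps into \<open>W\<close>.\<close>

lemma countable_d_open_subgroup:
  assumes "second_countable X" and F: "countable F" "\<And>f. f \<in> F \<Longrightarrow> action_uniform f"
    and S: "countable S" "S \<subseteq> carrier G"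
  obtains A where "subgroup A G" "countable A" "S \<subseteq> A"
    "\<And>K \<epsilon> x. \<lbrakk>finite K; K \<subseteq> translates F A; \<epsilon> > 0; x \<in> topspace X\<rbrakk>
      \<Longrightarrow> x \<in> X interior_of (X closure_of ((\<lambda>g. \<alpha> g x) ` (A \<inter> nearly_fixing K \<epsilon>)))"
proof -
  obtain \<B> where \<B>: "countable \<B>" "\<And>V. V \<in> \<B> \<Longrightarrow> openin X V"
    and base: "\<And>U x. \<lbrakk>openin X U; x \<in> U\<rbrakk> \<Longrightarrow> \<exists>V\<in>\<B>. x \<in> V \<and> V \<subseteq> U"
    using assms(1) unfolding second_countable_def by metis
  define P where "P V W fs n l = {g \<in> nearly_fixing (translates (set fs) (set l)) (1 / real (Suc n)). \<alpha> g ` V \<subseteq> W}"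
    for V W :: "'x set" and fs :: "('x \<Rightarrow> real) list" and n :: nat and l :: "'a list"
  \<comment> \<open>Lists of length at most two encode the group operations.\<close>
  define op where "op j l = (case j of
      None \<Rightarrow> (case l of [] \<Rightarrow> \<one> | [g] \<Rightarrow> inv g | g # h # _ \<Rightarrow> g \<otimes> h)
    | Some (V, W, fs, n) \<Rightarrow> if P V W fs n l = {} then \<one> else SOME g. g \<in> P V W fs n l)" for j l
  define J where "J = insert None (Some ` (\<B> \<times> \<B> \<times> lists F \<times> (UNIV :: nat set)))"
  have some_P: "(SOME g. g \<in> P V W fs n l) \<in> P V W fs n l" if "P V W fs n l \<noteq> {}" for V W fs n l
    using that by (simp add: some_in_eq)
  have P_carrier: "P V W fs n l \<subseteq> carrier G" for V W fs n l
    by (auto simp: P_def nearly_fixing_def)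
  have some_carrier: "(SOME g. g \<in> P V W fs n l) \<in> carrier G" if "P V W fs n l \<noteq> {}" for V W fs n l
    using some_P[OF that] P_carrier[of V W fs n l] by blast
  have J: "countable J"
    using \<B>(1) F(1) by (auto simp: J_def)
  have op_closed: "op j l \<in> carrier G" if "j \<in> J" "l \<in> lists (carrier G)" for j l
  proof (cases j)
    case None
    then show ?thesis
      using that by (auto simp: op_def split: list.split)
  next
    case (Some p)
    then show ?thesis
      by (cases p) (auto simp: op_def intro: some_carrier)
  qed
  obtain A where A: "countable A" "S \<subseteq> A" "A \<subseteq> carrier G"
    and closed: "\<And>j l. \<lbrakk>j \<in> J; l \<in> lists A\<rbrakk> \<Longrightarrow> op j l \<in> A"
    using countable_closure_under_operations[of J S "carrier G" op, OF J S op_closed] by metis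
  have "subgroup A G"
  proof
    show "x \<otimes> y \<in> A" if "x \<in> A" "y \<in> A" for x y
      using closed[of None "[x, y]"] that by (simp add: J_def op_def)
    show "\<one> \<in> A"
      using closed[of None "[]"] by (simp add: J_def op_def)
    show "inv x \<in> A" if "x \<in> A" for x
      using closed[of None "[x]"] that by (simp add: J_def op_def)
  qed (rule A(3))
  moreover
  have "x \<in> X interior_of (X closure_of ((\<lambda>g. \<alpha> g x) ` (A \<inter> nearly_fixing K \<epsilon>)))"
    if K: "finite K" "K \<subseteq> translates F A" and "\<epsilon> > 0" and x: "x \<in> topspace X" for K \<epsilon> x
  proof -
    obtain n where n: "1 / real (Suc n) < \<epsilon>"
      using \<open>\<epsilon> > 0\<close> by (metis inverse_eq_divide reals_Archimedean)
    obtain Q where Q: "finite Q" "Q \<subseteq> F \<times> A" "K = (\<lambda>(f, h) x. f (\<alpha> h x)) ` Q"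
      using finite_subset_image[OF K[unfolded translates_def]] by metis
    \<comment> \<open>Replacing \<open>K\<close> by all composites of the functions in \<open>fs\<close> with the elements of \<open>l\<close> only
      shrinks the neighbourhood, and makes it one of those for which \<open>op\<close> chooses elements.\<close>
    obtain fs l where fs: "set fs = fst ` Q" and l: "set l = snd ` Q"
      using Q(1) by (meson finite_imageI finite_list)
    have "fst ` Q \<subseteq> F" "snd ` Q \<subseteq> A"
      using Q(2) by auto
    then have fsl: "fs \<in> lists F" "l \<in> lists A"
      by (simp_all add: lists_eq_set fs l)
    let ?K = "translates (set fs) (set l)"
    have "K \<subseteq> ?K"
      unfolding Q(3) translates_def fs l by (intro image_mono) force
    then have near: "nearly_fixing ?K (1 / real (Suc n)) \<subseteq> nearly_fixing K \<epsilon>"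
      using n unfolding nearly_fixing_def by (auto simp del: of_nat_Suc) (meson less_imp_le order_trans subsetD)
    have "finite ?K"
      by (simp add: translates_def)
    moreover have "action_uniform f" if "f \<in> ?K" for f
      using that fsl F(2) A(3) unfolding translates_def by (auto intro!: action_uniform_translate)
    ultimately obtain O' where O': "openin T O'" "\<one> \<in> O'" "O' \<subseteq> nearly_fixing ?K (1 / real (Suc n))"
      using nearly_fixing_neighbourhood[of ?K "1 / real (Suc n)"] by auto
    have "(\<lambda>g. \<alpha> g x) ` O' \<subseteq> X closure_of ((\<lambda>g. \<alpha> g x) ` (A \<inter> nearly_fixing K \<epsilon>))"
    proof clarify
      fix g assume "g \<in> O'"
      then have g: "g \<in> carrier G" "g \<in> nearly_fixing ?K (1 / real (Suc n))"
        using O' by (auto simp: nearly_fixing_def)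
      show "\<alpha> g x \<in> X closure_of ((\<lambda>g. \<alpha> g x) ` (A \<inter> nearly_fixing K \<epsilon>))"
        unfolding in_closure_of
      proof (intro conjI allI impI)
        fix U assume "\<alpha> g x \<in> U \<and> openin X U"
        then obtain W where W: "W \<in> \<B>" "\<alpha> g x \<in> W" "W \<subseteq> U"
          using base by blast
        have "openin X {y \<in> topspace X. \<alpha> g y \<in> W}"
          using continuous_translation[OF g(1)] \<B>(2)[OF W(1)] by (rule openin_continuous_map_preimage)
        then obtain V where V: "V \<in> \<B>" "x \<in> V" "V \<subseteq> {y \<in> topspace X. \<alpha> g y \<in> W}"
          using base[of "{y \<in> topspace X. \<alpha> g y \<in> W}" x] W x by auto
        define h where "h = op (Some (V, W, fs, n)) l"
        have "g \<in> P V W fs n l"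
          using g(2) V(3) by (auto simp: P_def)
        then have "h \<in> P V W fs n l"
          using some_P[of V W fs n l] by (auto simp: h_def op_def)
        moreover have "h \<in> A"
          unfolding h_def using W V fsl by (intro closed) (auto simp: J_def)
        ultimately have "\<alpha> h x \<in> (\<lambda>g. \<alpha> g x) ` (A \<inter> nearly_fixing K \<epsilon>)" "\<alpha> h x \<in> U"
          using near V(2) W(3) unfolding P_def by auto
        then show "\<exists>y. y \<in> (\<lambda>g. \<alpha> g x) ` (A \<inter> nearly_fixing K \<epsilon>) \<and> y \<in> U"
          by blast
      qed (use g x in auto)
    qed
    then have "X closure_of ((\<lambda>g. \<alpha> g x) ` O') \<subseteq> X closure_of ((\<lambda>g. \<alpha> g x) ` (A \<inter> nearly_fixing K \<epsilon>))"
      by (intro closure_of_minimal) auto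
    then show ?thesis
      using d_openD[OF x O'(1,2)] interior_of_mono by blast
  qed
  ultimately show thesis
    using that A by blast
qed

end

section \<open>Actions by reindexing coordinates\<close>

lemma mspace_funspace_real:
  fixes \<phi> :: "'x \<Rightarrow> real"
  shows "restrict \<phi> S \<in> mspace (funspace S euclidean_metric) \<longleftrightarrow> bounded (\<phi> ` S)"
  by (simp add: Met_TC.fspace_def image_restrict_eq)

lemma mdist_funspace_le:
  fixes \<phi> \<psi> :: "'x \<Rightarrow> real"
  assumes "\<epsilon> \<ge> 0" "\<And>x. x \<in> S \<Longrightarrow> \<bar>\<phi> x - \<psi> x\<bar> \<le> \<epsilon>"
  shows "mdist (funspace S euclidean_metric) (restrict \<phi> S) (restrict \<psi> S) \<le> \<epsilon>"
  using assms by (auto simp: Met_TC.fdist_def dist_real_def intro!: cSUP_least)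

lemma le_mdist_funspace:
  fixes \<phi> \<psi> :: "'x \<Rightarrow> real"
  assumes "bounded (\<phi> ` S)" "bounded (\<psi> ` S)" "x \<in> S"
  shows "\<bar>\<phi> x - \<psi> x\<bar> \<le> mdist (funspace S euclidean_metric) (restrict \<phi> S) (restrict \<psi> S)"
proof -
  have mem: "restrict \<phi> S \<in> Met_TC.fspace S" "restrict \<psi> S \<in> Met_TC.fspace S"
    using assms mspace_funspace_real[of \<phi> S] mspace_funspace_real[of \<psi> S] by simp_all
  have "S \<noteq> {}"
    using assms by blast
  have "dist (restrict \<phi> S x) (restrict \<psi> S x) \<le> Sup ((\<lambda>x. dist (restrict \<phi> S x) (restrict \<psi> S x)) ` S)"
    using Met_TC.bdd_above_dist[OF mem \<open>S \<noteq> {}\<close>] assms(3) by (intro cSUP_upper)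
  then show ?thesis
    using mem \<open>S \<noteq> {}\<close> assms(3) by (simp add: Met_TC.fdist_def dist_real_def)
qed

lemma embedding_map_pullback_topology:
  assumes "inj_on f A" "f ` A \<subseteq> topspace Y"
  shows "embedding_map (pullback_topology A f Y) Y f"
proof -
  have top: "topspace (pullback_topology A f Y) = A"
    using assms(2) by (auto simp: topspace_pullback_topology)
  have "continuous_map (pullback_topology A f Y) Y f"
    using continuous_map_pullback[OF continuous_map_id, of A f Y] by simp
  moreover have "open_map (pullback_topology A f Y) (subtopology Y (f ` A)) f"
    unfolding open_map_def openin_pullback_topology openin_subtopology by blast
  ultimately show ?thesis
    unfolding embedding_map_def top using assms top
    by (intro bijective_open_imp_homeomorphic_map)
       (auto simp: continuous_map_in_subtopology)
qed

lemma continuous_map_cube_projection: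
  "continuous_map (product_topology (\<lambda>_. top_of_set {0..1}) UNIV) (top_of_set {0..1::real}) (\<lambda>b. b i)"
  using continuous_map_product_projection[of i UNIV "\<lambda>_. top_of_set {0..1::real}"] by simp

lemma continuous_map_cube_projection_real:
  "continuous_map (product_topology (\<lambda>_. top_of_set {0..1}) UNIV) euclideanreal (\<lambda>b. b i)"
  using continuous_map_cube_projection[of i] by (rule continuous_map_into_fulltopology)

text \<open>The set where coordinate \<open>i\<close> is below \<open>1/2\<close> is open in the cube and cuts out a neighbourhood
  of \<open>x\<close> inside \<open>U\<close>, so the image of an open set is open in the image of the space.\<close>

lemma embedding_map_separating_functions:
  fixes f :: "'i \<Rightarrow> 'x \<Rightarrow> real"
  assumes X: "Hausdorff_space X"
    and cont: "\<And>i. continuous_map X euclideanreal (f i)"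
    and range: "\<And>i x. x \<in> topspace X \<Longrightarrow> f i x \<in> {0..1}"
    and sep: "\<And>U x. \<lbrakk>openin X U; x \<in> U\<rbrakk> \<Longrightarrow> \<exists>i. f i x < 1/2 \<and> (\<forall>y\<in>topspace X - U. f i y = 1)"
  shows "embedding_map X (product_topology (\<lambda>_. top_of_set {0..1}) UNIV) (\<lambda>x i. f i x)"
proof -
  let ?C = "product_topology (\<lambda>_::'i. top_of_set {0..1::real}) UNIV"
  let ?e = "\<lambda>x i. f i x"
  have cont_e: "continuous_map X ?C ?e"
    using cont range by (auto simp: continuous_map_componentwise_UNIV continuous_map_in_subtopology)
  have inj: "inj_on ?e (topspace X)"
  proof (intro inj_onI, rule ccontr)
    fix x y assume xy: "x \<in> topspace X" "y \<in> topspace X" "?e x = ?e y" "x \<noteq> y"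
    then obtain U V where "openin X U" "openin X V" "x \<in> U" "y \<in> V" "disjnt U V"
      using X unfolding Hausdorff_space_def by metis
    then obtain i where "f i x < 1/2" "f i y = 1"
      using sep[of U x] xy(2) unfolding disjnt_iff by blast
    then show False
      using fun_cong[OF xy(3), of i] by simp
  qed
  have "open_map X (subtopology ?C (?e ` topspace X)) ?e"
    unfolding open_map_def
  proof (intro allI impI)
    fix U assume U: "openin X U"
    show "openin (subtopology ?C (?e ` topspace X)) (?e ` U)"
    proof (subst openin_subopen, intro ballI)
      fix b assume "b \<in> ?e ` U"
      then obtain x where x: "x \<in> U" "b = ?e x"
        by blast
      obtain i where i: "f i x < 1/2" "\<And>y. y \<in> topspace X - U \<Longrightarrow> f i y = 1"
        using sep[OF U x(1)] by blast
      let ?W = "{b \<in> topspace ?C. b i \<in> {..<1/2}}"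
      have "continuous_map ?C euclideanreal (\<lambda>b. b i)"
        by (rule continuous_map_cube_projection_real)
      then have "openin ?C ?W"
        by (rule openin_continuous_map_preimage) simp
      then have "openin (subtopology ?C (?e ` topspace X)) (?W \<inter> ?e ` topspace X)"
        by (rule openin_subtopology_Int)
      moreover have "b \<in> ?W \<inter> ?e ` topspace X"
        using x i(1) openin_subset[OF U] range by auto
      moreover have "?W \<inter> ?e ` topspace X \<subseteq> ?e ` U"
      proof clarsimp
        fix y assume "y \<in> topspace X" "f i y * 2 < 1"
        then show "?e y \<in> ?e ` U"
          using i(2)[of y] by (cases "y \<in> U") auto
      qed
      ultimately show "\<exists>W. openin (subtopology ?C (?e ` topspace X)) W \<and> b \<in> W \<and> W \<subseteq> ?e ` U"
        by blast
    qed
  qed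
  then show ?thesis
    unfolding embedding_map_def using cont_e inj continuous_map_image_subset_topspace[OF cont_e]
    by (intro bijective_open_imp_homeomorphic_map)
       (simp_all add: continuous_map_in_subtopology Int_absorb1)
qed

text \<open>Bijectivity comes for free, as \<open>inv g\<close> acts as the inverse map.\<close>

lemma group_action_restrictI:
  assumes "group K"
    and closed: "\<And>g x. \<lbrakk>g \<in> carrier K; x \<in> E\<rbrakk> \<Longrightarrow> \<gamma> g x \<in> E"
    and one: "\<And>x. x \<in> E \<Longrightarrow> \<gamma> \<one>\<^bsub>K\<^esub> x = x"
    and mult: "\<And>g h x. \<lbrakk>g \<in> carrier K; h \<in> carrier K; x \<in> E\<rbrakk> \<Longrightarrow> \<gamma> (g \<otimes>\<^bsub>K\<^esub> h) x = \<gamma> g (\<gamma> h x)"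
  shows "group_action K E (\<lambda>g. restrict (\<gamma> g) E)"
proof -
  interpret group K by fact
  have Bij: "restrict (\<gamma> g) E \<in> Bij E" if g: "g \<in> carrier K" for g
  proof -
    have "bij_betw (\<gamma> g) E E"
      by (rule bij_betw_byWitness[where f' = "\<gamma> (inv\<^bsub>K\<^esub> g)"])
        (use g closed in \<open>auto simp: one simp flip: mult\<close>)
    then show ?thesis
      by (simp add: Bij_def)
  qed
  have "(\<lambda>g. restrict (\<gamma> g) E) \<in> hom K (BijGroup E)"
  proof (rule homI)
    fix g h assume "g \<in> carrier K" "h \<in> carrier K"
    then show "restrict (\<gamma> (g \<otimes>\<^bsub>K\<^esub> h)) E = restrict (\<gamma> g) E \<otimes>\<^bsub>BijGroup E\<^esub> restrict (\<gamma> h) E"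
      using Bij closed mult by (auto simp: BijGroup_def compose_def fun_eq_iff)
  qed (simp add: BijGroup_def Bij)
  then show ?thesis
    by (simp add: group_action_def group_hom_def group_hom_axioms_def group_BijGroup is_group)
qed

text \<open>What remains of the situation once the subgroup and the functions have been chosen. The
  group carries no topology; \<open>\<sigma> g i\<close> is the index of the coordinate \<open>f i\<close> composed with \<open>g\<close>, and
  \<open>dense_small_orbits\<close> is \<open>d\<close>-openness for the sets that will be the basic neighbourhoods of the
  unit.\<close>

locale coordinate_action = group K for K (structure) +
  fixes X :: "'x topology" and \<alpha> :: "'k \<Rightarrow> 'x \<Rightarrow> 'x"
    and f :: "nat \<Rightarrow> 'x \<Rightarrow> real" and \<sigma> :: "'k \<Rightarrow> nat \<Rightarrow> nat"
  assumes Hausdorff: "Hausdorff_space X"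
    and act_closed [simp, intro]: "\<lbrakk>g \<in> carrier K; x \<in> topspace X\<rbrakk> \<Longrightarrow> \<alpha> g x \<in> topspace X"
    and act_one [simp]: "x \<in> topspace X \<Longrightarrow> \<alpha> \<one> x = x"
    and act_mult: "\<lbrakk>g \<in> carrier K; h \<in> carrier K; x \<in> topspace X\<rbrakk> \<Longrightarrow> \<alpha> (g \<otimes> h) x = \<alpha> g (\<alpha> h x)"
    and faithful: "\<lbrakk>g \<in> carrier K; h \<in> carrier K; \<And>x. x \<in> topspace X \<Longrightarrow> \<alpha> g x = \<alpha> h x\<rbrakk> \<Longrightarrow> g = h"
    and coordinate_continuous: "continuous_map X euclideanreal (f i)"
    and coordinate_range: "x \<in> topspace X \<Longrightarrow> f i x \<in> {0..1}"
    and separating: "\<lbrakk>openin X U; x \<in> U\<rbrakk> \<Longrightarrow> \<exists>i. f i x < 1/2 \<and> (\<forall>y\<in>topspace X - U. f i y = 1)"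
    and coordinate_shift: "\<lbrakk>g \<in> carrier K; x \<in> topspace X\<rbrakk> \<Longrightarrow> f (\<sigma> g i) x = f i (\<alpha> g x)"
    and dense_small_orbits: "\<lbrakk>finite I; \<epsilon> > 0; x \<in> topspace X\<rbrakk> \<Longrightarrow>
      x \<in> X interior_of (X closure_of
        ((\<lambda>g. \<alpha> g x) ` {g \<in> carrier K. \<forall>i\<in>I. \<forall>y\<in>topspace X. \<bar>f i (\<alpha> g y) - f i y\<bar> \<le> \<epsilon>}))"
begin

definition cube :: "(nat \<Rightarrow> real) topology"
  where "cube = product_topology (\<lambda>_. top_of_set {0..1}) UNIV"

definition coordinates :: "'x \<Rightarrow> nat \<Rightarrow> real"
  where "coordinates x = (\<lambda>i. f i x)"

definition compactum :: "(nat \<Rightarrow> real) topology"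
  where "compactum = subtopology cube (cube closure_of (coordinates ` topspace X))"

text \<open>On the image of \<open>X\<close> this is the given action. Being defined by reindexing, it extends
  continuously to the whole cube; the group laws carry over to the closure of the image by
  density.\<close>

definition permute :: "'k \<Rightarrow> (nat \<Rightarrow> real) \<Rightarrow> nat \<Rightarrow> real"
  where "permute g b = (\<lambda>i. b (\<sigma> g i))"

lemma compact_cube: "compact_space cube" and Hausdorff_cube: "Hausdorff_space cube"
  and metrizable_cube: "metrizable_space cube"
  unfolding cube_def
  by (simp_all add: compact_space_product_topology compact_space_subtopology Hausdorff_space_product_topology
      Hausdorff_space_subtopology metrizable_space_product_topology metrizable_space_subtopology
      metrizable_space_euclidean)

lemma topspace_compactum: "topspace compactum = cube closure_of (coordinates ` topspace X)"
  using closure_of_subset_topspace[of cube] by (auto simp: compactum_def)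

lemma continuous_map_into_compactum:
  "continuous_map Z compactum F \<longleftrightarrow> continuous_map Z cube F \<and> F \<in> topspace Z \<rightarrow> topspace compactum"
  unfolding topspace_compactum by (simp add: compactum_def continuous_map_in_subtopology)

lemma embedding_coordinates_cube: "embedding_map X cube coordinates"
  using embedding_map_separating_functions[OF Hausdorff coordinate_continuous coordinate_range separating]
  by (simp add: cube_def coordinates_def[abs_def])

lemma coordinates_subset_cube: "coordinates ` topspace X \<subseteq> topspace cube"
  using coordinate_range by (auto simp: cube_def coordinates_def)

lemma coordinates_subset: "coordinates ` topspace X \<subseteq> topspace compactum"
  unfolding topspace_compactum by (rule closure_of_subset[OF coordinates_subset_cube])

lemma compactification_compactum: "compactification X coordinates compactum"
  unfolding compactification_def
proof (intro conjI)
  show "compact_space compactum"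
    unfolding compactum_def using compact_cube by (simp add: closedin_compact_space compact_space_subtopology)
  show "Hausdorff_space compactum"
    unfolding compactum_def by (intro Hausdorff_space_subtopology Hausdorff_cube)
  show "embedding_map X compactum coordinates"
    using embedding_coordinates_cube closure_of_subset[OF coordinates_subset_cube]
    by (simp add: compactum_def embedding_map_in_subtopology)
  show "compactum closure_of coordinates ` topspace X = topspace compactum"
    using closure_of_subset[OF coordinates_subset_cube] unfolding topspace_compactum
    by (simp add: compactum_def closure_of_subtopology Int_absorb1)
qed

lemma metrizable_compactum: "metrizable_space compactum"
  unfolding compactum_def by (intro metrizable_space_subtopology metrizable_cube)

lemma permute_coordinates:
  "\<lbrakk>g \<in> carrier K; x \<in> topspace X\<rbrakk> \<Longrightarrow> permute g (coordinates x) = coordinates (\<alpha> g x)"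
  by (simp add: permute_def coordinates_def coordinate_shift)

lemma continuous_projection: "continuous_map cube euclideanreal (\<lambda>b. b i)"
  unfolding cube_def by (rule continuous_map_cube_projection_real)

lemma continuous_permute: "continuous_map cube cube (permute g)"
  unfolding permute_def cube_def continuous_map_componentwise_UNIV
  by (intro allI continuous_map_cube_projection)

lemma permute_closed:
  assumes "g \<in> carrier K" "b \<in> topspace compactum"
  shows "permute g b \<in> topspace compactum"
proof -
  have "permute g b \<in> cube closure_of (permute g ` coordinates ` topspace X)"
    using continuous_map_image_closure_subset[OF continuous_permute] assms(2)
    unfolding topspace_compactum by blast
  moreover have "permute g ` coordinates ` topspace X \<subseteq> coordinates ` topspace X"
    using assms(1) by (auto simp: permute_coordinates)
  ultimately show ?thesis
    unfolding topspace_compactum using closure_of_mono by blast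
qed

lemma permute_one: "b \<in> topspace compactum \<Longrightarrow> permute \<one> b = b"
  unfolding topspace_compactum
  by (erule forall_in_closure_of_eq[OF _ Hausdorff_cube continuous_permute continuous_map_id[unfolded id_def]])
     (auto simp: permute_coordinates)

lemma permute_mult:
  assumes "g \<in> carrier K" "h \<in> carrier K" "b \<in> topspace compactum"
  shows "permute (g \<otimes> h) b = permute g (permute h b)"
proof -
  have "continuous_map cube cube (\<lambda>b. permute g (permute h b))"
    using continuous_map_compose[OF continuous_permute continuous_permute] by (simp add: o_def)
  then show ?thesis
    using assms(3) unfolding topspace_compactum
    by (elim forall_in_closure_of_eq[OF _ Hausdorff_cube continuous_permute, rotated])
       (use assms in \<open>auto simp: permute_coordinates act_mult\<close>)
qed

text \<open>The distance in coordinate \<open>i\<close> is a continuous function on the compactum, so a bound on the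
  dense image of \<open>X\<close> persists.\<close>

lemma permute_close:
  assumes gh: "g \<in> carrier K" "h \<in> carrier K"
    and close: "\<And>x. x \<in> topspace X \<Longrightarrow> \<bar>f i (\<alpha> g x) - f i (\<alpha> h x)\<bar> \<le> \<epsilon>"
    and b: "b \<in> topspace compactum"
  shows "\<bar>permute g b i - permute h b i\<bar> \<le> \<epsilon>"
proof (rule forall_in_closure_of[where P = "\<lambda>b. \<bar>permute g b i - permute h b i\<bar> \<le> \<epsilon>"])
  show "b \<in> cube closure_of (coordinates ` topspace X)"
    using b by (simp add: topspace_compactum)
  show "\<bar>permute g b i - permute h b i\<bar> \<le> \<epsilon>" if "b \<in> coordinates ` topspace X" for b
    using that close gh by (auto simp: permute_coordinates) (simp add: coordinates_def)
  have "continuous_map cube euclideanreal (\<lambda>b. \<bar>b (\<sigma> g i) - b (\<sigma> h i)\<bar>)"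
    by (intro continuous_map_real_abs continuous_map_diff continuous_projection)
  then have "closedin cube {b \<in> topspace cube. \<bar>b (\<sigma> g i) - b (\<sigma> h i)\<bar> \<in> {..\<epsilon>}}"
    by (rule closedin_continuous_map_preimage) simp
  then show "closedin cube {b \<in> topspace cube. \<bar>permute g b i - permute h b i\<bar> \<le> \<epsilon>}"
    by (simp add: permute_def)
qed

text \<open>The topology of uniform convergence of all coordinates: \<open>g\<close> is identified with the sequence
  of bounded functions \<open>f i \<circ> \<alpha> g\<close>, each taken in its supremum metric. Metrizability is inherited
  from this countable product of metric spaces.\<close>

definition displacement :: "'k \<Rightarrow> nat \<Rightarrow> 'x \<Rightarrow> real"
  where "displacement g = (\<lambda>i. \<lambda>x\<in>topspace X. f i (\<alpha> g x))"

definition uniform_target :: "(nat \<Rightarrow> 'x \<Rightarrow> real) topology"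
  where "uniform_target = product_topology (\<lambda>_. mtopology_of (funspace (topspace X) euclidean_metric)) UNIV"

definition uniform_topology :: "'k topology"
  where "uniform_topology = pullback_topology (carrier K) displacement uniform_target"

lemma bounded_coordinate: "g \<in> carrier K \<Longrightarrow> bounded ((\<lambda>x. f i (\<alpha> g x)) ` topspace X)"
  using coordinate_range by (intro bounded_subset[OF bounded_closed_interval[of 0 1]]) blast

lemma displacement_in: "g \<in> carrier K \<Longrightarrow> displacement g i \<in> mspace (funspace (topspace X) euclidean_metric)"
  unfolding displacement_def mspace_funspace_real by (rule bounded_coordinate)

lemma displacement_in_target: "displacement ` carrier K \<subseteq> topspace uniform_target"
  using displacement_in by (auto simp: uniform_target_def simp del: mspace_funspace)

lemma topspace_uniform: "topspace uniform_topology = carrier K"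
  using displacement_in_target by (auto simp: uniform_topology_def topspace_pullback_topology)

text \<open>This lemma and \<open>uniform_neighbourhood\<close> reduce continuity into and out of the group to
  estimates in one coordinate, uniform over \<open>X\<close>.\<close>

lemma continuous_map_into_uniform:
  assumes F: "F ` topspace Z \<subseteq> carrier K"
    and close: "\<And>z i \<epsilon>. \<lbrakk>z \<in> topspace Z; \<epsilon> > 0\<rbrakk> \<Longrightarrow> \<exists>U. openin Z U \<and> z \<in> U \<and>
      (\<forall>w\<in>U. \<forall>x\<in>topspace X. \<bar>f i (\<alpha> (F z) x) - f i (\<alpha> (F w) x)\<bar> \<le> \<epsilon>)"
  shows "continuous_map Z uniform_topology F"
  unfolding uniform_topology_def
proof (rule continuous_map_pullback')
  let ?m = "funspace (topspace X) euclidean_metric :: ('x \<Rightarrow> real) metric"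
  have "continuous_map Z (mtopology_of ?m) (\<lambda>z. displacement (F z) i)" for i
    unfolding mtopology_of_def Metric_space.continuous_map_to_metric[OF Metric_space_mspace_mdist]
  proof (intro ballI allI impI)
    fix z and \<epsilon> :: real assume z: "z \<in> topspace Z" and "\<epsilon> > 0"
    then obtain U where U: "openin Z U" "z \<in> U"
      and small: "\<And>w x. \<lbrakk>w \<in> U; x \<in> topspace X\<rbrakk> \<Longrightarrow> \<bar>f i (\<alpha> (F z) x) - f i (\<alpha> (F w) x)\<bar> \<le> \<epsilon> / 2"
      using close[of z "\<epsilon> / 2" i] by auto
    have "displacement (F w) i \<in> Metric_space.mball (mspace ?m) (mdist ?m) (displacement (F z) i) \<epsilon>" if "w \<in> U" for w
    proof -
      have "F w \<in> carrier K" "F z \<in> carrier K"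
        using that z F openin_subset[OF U(1)] by auto
      then have mem: "displacement (F w) i \<in> mspace ?m" "displacement (F z) i \<in> mspace ?m"
        by (simp_all only: displacement_in)
      have "mdist ?m (displacement (F z) i) (displacement (F w) i) \<le> \<epsilon> / 2"
        unfolding displacement_def using small[OF that] \<open>\<epsilon> > 0\<close> by (intro mdist_funspace_le) auto
      with mem \<open>\<epsilon> > 0\<close> show ?thesis
        by (simp add: Metric_space.in_mball[OF Metric_space_mspace_mdist] del: mspace_funspace mdist_funspace)
    qed
    with U show "\<exists>U. openin Z U \<and> z \<in> U \<and>
        (\<forall>w\<in>U. displacement (F w) i \<in> Metric_space.mball (mspace ?m) (mdist ?m) (displacement (F z) i) \<epsilon>)"
      by blast
  qed
  then show "continuous_map Z uniform_target (displacement \<circ> F)"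
    by (simp add: uniform_target_def continuous_map_componentwise_UNIV o_def)
  show "topspace Z \<subseteq> F -` carrier K"
    using F by blast
qed

lemma uniform_neighbourhood:
  assumes g: "g \<in> carrier K" and "\<epsilon> > 0"
  obtains U where "openin uniform_topology U" "g \<in> U"
    "\<And>h x. \<lbrakk>h \<in> U; x \<in> topspace X\<rbrakk> \<Longrightarrow> \<bar>f i (\<alpha> g x) - f i (\<alpha> h x)\<bar> \<le> \<epsilon>"
proof -
  let ?m = "funspace (topspace X) euclidean_metric :: ('x \<Rightarrow> real) metric"
  have proj: "continuous_map uniform_target (mtopology_of ?m) (\<lambda>b. b i)"
    unfolding uniform_target_def by (rule continuous_map_product_projection) simp
  have "continuous_map uniform_topology (mtopology_of ?m) ((\<lambda>b. b i) \<circ> displacement)"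
    unfolding uniform_topology_def by (rule continuous_map_pullback[OF proj])
  then have "\<forall>g\<in>carrier K. \<forall>\<epsilon>>0. \<exists>U. openin uniform_topology U \<and> g \<in> U \<and>
      (\<forall>h\<in>U. displacement h i \<in> Metric_space.mball (mspace ?m) (mdist ?m) (displacement g i) \<epsilon>)"
    unfolding mtopology_of_def Metric_space.continuous_map_to_metric[OF Metric_space_mspace_mdist]
      topspace_uniform o_def .
  from this[rule_format, OF g \<open>\<epsilon> > 0\<close>] obtain U where U: "openin uniform_topology U" "g \<in> U"
    and ball: "\<And>h. h \<in> U \<Longrightarrow> displacement h i \<in> Metric_space.mball (mspace ?m) (mdist ?m) (displacement g i) \<epsilon>"
    by (elim exE conjE) (simp del: mspace_funspace mdist_funspace)
  have "\<bar>f i (\<alpha> g x) - f i (\<alpha> h x)\<bar> \<le> \<epsilon>" if h: "h \<in> U" and x: "x \<in> topspace X" for h x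
  proof -
    have "h \<in> carrier K"
      using openin_subset[OF U(1)] h topspace_uniform by blast
    then have "\<bar>f i (\<alpha> g x) - f i (\<alpha> h x)\<bar> \<le> mdist ?m (displacement g i) (displacement h i)"
      unfolding displacement_def using g x by (intro le_mdist_funspace bounded_coordinate)
    also have "\<dots> < \<epsilon>"
      using ball[OF h] by (simp add: Metric_space.in_mball[OF Metric_space_mspace_mdist] del: mspace_funspace mdist_funspace)
    finally show ?thesis by simp
  qed
  then show thesis
    using that U by blast
qed

text \<open>A neighbourhood in the product restricts only finitely many coordinates, and a positive
  radius that suits all of them exists.\<close>

lemma uniform_neighbourhood_base:
  assumes U: "openin uniform_topology U" "\<one> \<in> U"
  obtains I \<epsilon> where "finite I" "\<epsilon> > 0"
    "{g \<in> carrier K. \<forall>i\<in>I. \<forall>x\<in>topspace X. \<bar>f i (\<alpha> g x) - f i x\<bar> \<le> \<epsilon>} \<subseteq> U"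
proof -
  let ?m = "funspace (topspace X) euclidean_metric :: ('x \<Rightarrow> real) metric"
  interpret m: Metric_space "mspace ?m" "mdist ?m" by (rule Metric_space_mspace_mdist)
  obtain V where V: "openin uniform_target V" "U = displacement -` V \<inter> carrier K"
    using U(1) unfolding uniform_topology_def openin_pullback_topology by blast
  have one_V: "displacement \<one> \<in> V"
    using U(2) V(2) by blast
  have "\<exists>W. finite {i \<in> UNIV. W i \<noteq> topspace (mtopology_of ?m)} \<and> (\<forall>i\<in>UNIV. openin (mtopology_of ?m) (W i)) \<and>
      displacement \<one> \<in> Pi\<^sub>E UNIV W \<and> Pi\<^sub>E UNIV W \<subseteq> V"
    using V(1) one_V unfolding uniform_target_def openin_product_topology_alt by (rule bspec)
  then obtain W where W: "finite {i. W i \<noteq> mspace ?m}" "\<And>i. openin m.mtopology (W i)"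
    and in_W: "\<And>i. displacement \<one> i \<in> W i" and WV: "Pi\<^sub>E UNIV W \<subseteq> V"
    by (auto simp: mtopology_of_def simp del: mspace_funspace mdist_funspace)
  have "\<exists>\<epsilon>>0. m.mball (displacement \<one> i) \<epsilon> \<subseteq> W i" for i
    using W(2)[of i] in_W[of i] by (auto simp: m.openin_mtopology simp del: mspace_funspace mdist_funspace)
  then obtain r where r: "\<And>i. r i > 0" "\<And>i. m.mball (displacement \<one> i) (r i) \<subseteq> W i"
    by metis
  define I where "I = {i. W i \<noteq> mspace ?m}"
  define \<epsilon> where "\<epsilon> = Min (insert 1 (r ` I)) / 2"
  have I: "finite I"
    using W(1) by (simp add: I_def)
  have min: "Min (insert 1 (r ` I)) > 0"
    using I r(1) by (subst Min_gr_iff) auto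
  then have "\<epsilon> > 0"
    by (simp add: \<epsilon>_def)
  have \<epsilon>_less: "\<epsilon> < r i" if "i \<in> I" for i
  proof -
    have "Min (insert 1 (r ` I)) \<le> r i"
      using I that by (intro Min_le) auto
    then show ?thesis
      using min by (simp add: \<epsilon>_def)
  qed
  have "g \<in> U" if g: "g \<in> carrier K" and close: "\<And>i x. \<lbrakk>i \<in> I; x \<in> topspace X\<rbrakk> \<Longrightarrow> \<bar>f i (\<alpha> g x) - f i x\<bar> \<le> \<epsilon>" for g
  proof -
    have "displacement g i \<in> W i" for i
    proof (cases "i \<in> I")
      case True
      have "mdist ?m (displacement \<one> i) (displacement g i) \<le> \<epsilon>"
        unfolding displacement_def using close[OF True] \<open>\<epsilon> > 0\<close>
        by (intro mdist_funspace_le) (auto simp: abs_minus_commute)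
      then have "displacement g i \<in> m.mball (displacement \<one> i) (r i)"
        using \<epsilon>_less[OF True] displacement_in[OF g, of i] displacement_in[OF one_closed, of i]
        by (simp add: m.in_mball del: mspace_funspace mdist_funspace)
      then show ?thesis
        using r(2) by blast
    next
      case False
      then show ?thesis
        using displacement_in[OF g, of i] by (simp add: I_def del: mspace_funspace)
    qed
    then have "displacement g \<in> V"
      using WV by auto
    then show ?thesis
      using V(2) g by blast
  qed
  then show thesis
    using that[OF I \<open>\<epsilon> > 0\<close>] by blast
qed

lemma act_inv_act: "\<lbrakk>g \<in> carrier K; x \<in> topspace X\<rbrakk> \<Longrightarrow> \<alpha> (inv g) (\<alpha> g x) = x"
  "\<lbrakk>g \<in> carrier K; x \<in> topspace X\<rbrakk> \<Longrightarrow> \<alpha> g (\<alpha> (inv g) x) = x"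
  by (simp_all flip: act_mult)

text \<open>Composites are estimated in two steps, first replacing \<open>h\<close> and then \<open>g\<close>. The coordinate \<open>f i
  \<circ> g\<close> is again a coordinate, namely \<open>\<sigma> g i\<close>, which turns closeness of \<open>h\<close> and \<open>h'\<close> into closeness
  after applying \<open>g\<close>. For inverses, the points of \<open>X\<close> are written as \<open>k y\<close> with \<open>y = (inv k) x\<close>.\<close>

lemma topological_group_uniform: "topological_group K uniform_topology"
proof (intro topological_group.intro is_group topological_group_axioms.intro topspace_uniform)
  show "continuous_map (prod_topology uniform_topology uniform_topology) uniform_topology (\<lambda>(g, h). g \<otimes> h)"
  proof (rule continuous_map_into_uniform)
    fix z i and \<epsilon> :: real
    assume "z \<in> topspace (prod_topology uniform_topology uniform_topology)" "\<epsilon> > 0"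
    then obtain g h where z: "z = (g, h)" and gh: "g \<in> carrier K" "h \<in> carrier K"
      by (auto simp: topspace_uniform)
    obtain U where U: "openin uniform_topology U" "g \<in> U"
      and g_close: "\<And>k x. \<lbrakk>k \<in> U; x \<in> topspace X\<rbrakk> \<Longrightarrow> \<bar>f i (\<alpha> g x) - f i (\<alpha> k x)\<bar> \<le> \<epsilon> / 2"
      using uniform_neighbourhood[OF gh(1), of "\<epsilon> / 2" i] \<open>\<epsilon> > 0\<close> by (metis half_gt_zero)
    obtain V where V: "openin uniform_topology V" "h \<in> V"
      and h_close: "\<And>k x. \<lbrakk>k \<in> V; x \<in> topspace X\<rbrakk> \<Longrightarrow> \<bar>f (\<sigma> g i) (\<alpha> h x) - f (\<sigma> g i) (\<alpha> k x)\<bar> \<le> \<epsilon> / 2"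
      using uniform_neighbourhood[OF gh(2), of "\<epsilon> / 2" "\<sigma> g i"] \<open>\<epsilon> > 0\<close> by (metis half_gt_zero)
    have "\<bar>f i (\<alpha> (g \<otimes> h) x) - f i (\<alpha> (g' \<otimes> h') x)\<bar> \<le> \<epsilon>"
      if "g' \<in> U" "h' \<in> V" and x: "x \<in> topspace X" for g' h' x
    proof -
      have g'h': "g' \<in> carrier K" "h' \<in> carrier K"
        using that openin_subset[OF U(1)] openin_subset[OF V(1)] topspace_uniform by auto
      have "\<bar>f i (\<alpha> g (\<alpha> h x)) - f i (\<alpha> g (\<alpha> h' x))\<bar> \<le> \<epsilon> / 2"
        using h_close[OF that(2) x] gh g'h' x by (simp add: coordinate_shift)
      moreover have "\<bar>f i (\<alpha> g (\<alpha> h' x)) - f i (\<alpha> g' (\<alpha> h' x))\<bar> \<le> \<epsilon> / 2"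
        using g_close[OF that(1)] g'h' x by simp
      ultimately have "\<bar>f i (\<alpha> g (\<alpha> h x)) - f i (\<alpha> g' (\<alpha> h' x))\<bar> \<le> \<epsilon>"
        by linarith
      then show ?thesis
        using gh g'h' x by (simp add: act_mult)
    qed
    then show "\<exists>U. openin (prod_topology uniform_topology uniform_topology) U \<and> z \<in> U \<and>
        (\<forall>w\<in>U. \<forall>x\<in>topspace X. \<bar>f i (\<alpha> (case z of (g, h) \<Rightarrow> g \<otimes> h) x) - f i (\<alpha> (case w of (g, h) \<Rightarrow> g \<otimes> h) x)\<bar> \<le> \<epsilon>)"
      using U V z by (intro exI[of _ "U \<times> V"]) (auto simp: openin_prod_Times_iff)
  qed (auto simp: topspace_uniform)
  show "continuous_map uniform_topology uniform_topology (\<lambda>g. inv g)"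
  proof (rule continuous_map_into_uniform)
    fix g i and \<epsilon> :: real
    assume "g \<in> topspace uniform_topology" "\<epsilon> > 0"
    then have g: "g \<in> carrier K"
      by (simp add: topspace_uniform)
    obtain U where U: "openin uniform_topology U" "g \<in> U"
      and close: "\<And>k x. \<lbrakk>k \<in> U; x \<in> topspace X\<rbrakk> \<Longrightarrow>
        \<bar>f (\<sigma> (inv g) i) (\<alpha> g x) - f (\<sigma> (inv g) i) (\<alpha> k x)\<bar> \<le> \<epsilon>"
      using uniform_neighbourhood[OF g \<open>\<epsilon> > 0\<close>, of "\<sigma> (inv g) i"] by metis
    have "\<bar>f i (\<alpha> (inv g) x) - f i (\<alpha> (inv k) x)\<bar> \<le> \<epsilon>" if k: "k \<in> U" and x: "x \<in> topspace X" for k x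
    proof -
      have kK: "k \<in> carrier K"
        using k openin_subset[OF U(1)] topspace_uniform by auto
      have "\<bar>f (\<sigma> (inv g) i) (\<alpha> g (\<alpha> (inv k) x)) - f (\<sigma> (inv g) i) (\<alpha> k (\<alpha> (inv k) x))\<bar> \<le> \<epsilon>"
        using close[OF k] kK x by simp
      then show ?thesis
        using g kK x by (simp add: coordinate_shift act_inv_act abs_minus_commute)
    qed
    then show "\<exists>U. openin uniform_topology U \<and> g \<in> U \<and>
        (\<forall>k\<in>U. \<forall>x\<in>topspace X. \<bar>f i (\<alpha> (inv g) x) - f i (\<alpha> (inv k) x)\<bar> \<le> \<epsilon>)"
      using U by blast
  qed (auto simp: topspace_uniform)
qed

lemma metrizable_uniform: "metrizable_space uniform_topology"
proof -
  have "inj_on displacement (carrier K)"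
  proof (rule inj_onI)
    fix g h assume gh: "g \<in> carrier K" "h \<in> carrier K" "displacement g = displacement h"
    have inj: "inj_on coordinates (topspace X)"
      using embedding_coordinates_cube by (simp add: embedding_map_def homeomorphic_map_def)
    show "g = h"
    proof (rule faithful[OF gh(1,2)])
      fix x assume x: "x \<in> topspace X"
      have "f i (\<alpha> g x) = f i (\<alpha> h x)" for i
        using fun_cong[OF fun_cong[OF gh(3), of i], of x] x by (simp add: displacement_def)
      then have "coordinates (\<alpha> g x) = coordinates (\<alpha> h x)"
        by (simp add: coordinates_def)
      then show "\<alpha> g x = \<alpha> h x"
        using inj gh(1,2) x by (simp add: inj_on_eq_iff)
    qed
  qed
  then have "embedding_map uniform_topology uniform_target displacement"
    unfolding uniform_topology_def using displacement_in_target by (rule embedding_map_pullback_topology)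
  then have "uniform_topology homeomorphic_space subtopology uniform_target (displacement ` topspace uniform_topology)"
    by (rule embedding_map_imp_homeomorphic_space)
  moreover have "metrizable_space uniform_target"
    unfolding uniform_target_def metrizable_space_product_topology
    by (simp add: mtopology_of_def Metric_space.metrizable_space_mtopology del: mspace_funspace mdist_funspace)
  ultimately show ?thesis
    by (metis homeomorphic_metrizable_space metrizable_space_subtopology)
qed

lemma continuous_permute_action:
  "continuous_map (prod_topology uniform_topology compactum) compactum (\<lambda>(g, b). permute g b)"
proof -
  let ?Z = "prod_topology uniform_topology compactum"
  have coord: "continuous_map ?Z euclideanreal (\<lambda>(g, b). permute g b i)" for i
    unfolding Met_TC.continuous_map_to_metric[unfolded mtopology_is_euclidean]
  proof (intro ballI allI impI)
    fix z and \<epsilon> :: real assume "z \<in> topspace ?Z" "\<epsilon> > 0"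
    then obtain g b where z: "z = (g, b)" and g: "g \<in> carrier K" and b: "b \<in> topspace compactum"
      by (auto simp: topspace_uniform)
    obtain U where U: "openin uniform_topology U" "g \<in> U"
      and close: "\<And>h x. \<lbrakk>h \<in> U; x \<in> topspace X\<rbrakk> \<Longrightarrow> \<bar>f i (\<alpha> g x) - f i (\<alpha> h x)\<bar> \<le> \<epsilon> / 2"
      using uniform_neighbourhood[OF g, of "\<epsilon> / 2" i] \<open>\<epsilon> > 0\<close> by (metis half_gt_zero)
    let ?V = "{c \<in> topspace compactum. c (\<sigma> g i) \<in> ball (b (\<sigma> g i)) (\<epsilon> / 2)}"
    have "continuous_map compactum euclideanreal (\<lambda>c. c (\<sigma> g i))"
      unfolding compactum_def by (intro continuous_map_from_subtopology continuous_projection)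
    then have V: "openin compactum ?V"
      by (rule openin_continuous_map_preimage) simp
    have "\<bar>permute g b i - permute h c i\<bar> < \<epsilon>" if "h \<in> U" "c \<in> ?V" for h c
    proof -
      have "h \<in> carrier K"
        using that openin_subset[OF U(1)] topspace_uniform by auto
      then have "\<bar>permute g c i - permute h c i\<bar> \<le> \<epsilon> / 2"
        using permute_close[OF g, of h i "\<epsilon> / 2" c] close that by auto
      moreover have "\<bar>permute g b i - permute g c i\<bar> < \<epsilon> / 2"
        using that by (simp add: permute_def dist_real_def)
      ultimately show ?thesis by linarith
    qed
    then show "\<exists>W. openin ?Z W \<and> z \<in> W \<and>
        (\<forall>w\<in>W. (case w of (g, b) \<Rightarrow> permute g b i) \<in> Met_TC.mball (case z of (g, b) \<Rightarrow> permute g b i) \<epsilon>)"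
      using U V z b \<open>\<epsilon> > 0\<close>
      by (intro exI[of _ "U \<times> ?V"]) (auto simp: openin_prod_Times_iff dist_real_def)
  qed
  have closed: "permute g b \<in> topspace compactum" if "(g, b) \<in> topspace ?Z" for g b
    using that permute_closed by (simp add: topspace_uniform)
  have in_cube: "b i \<in> {0..1}" if "b \<in> topspace compactum" for b i
    using that closure_of_subset_topspace[of cube] unfolding topspace_compactum
    by (fastforce simp: cube_def)
  have "continuous_map ?Z (top_of_set {0..1}) (\<lambda>z. (case z of (g, b) \<Rightarrow> permute g b) i)" for i
    unfolding continuous_map_in_subtopology using coord[of i] in_cube[OF closed]
    by (auto simp: case_prod_unfold)
  then have "continuous_map ?Z cube (\<lambda>(g, b). permute g b)"
    unfolding cube_def continuous_map_componentwise_UNIV by (rule allI)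
  moreover have "(\<lambda>(g, b). permute g b) \<in> topspace ?Z \<rightarrow> topspace compactum"
    using closed by auto
  ultimately show ?thesis
    by (subst continuous_map_into_compactum) blast
qed

lemma continuous_action_compactum: "continuous_action K uniform_topology compactum permute"
  unfolding continuous_action_def
  by (intro conjI group_action_restrictI is_group continuous_permute_action)
     (simp_all add: permute_closed permute_one permute_mult)

text \<open>The embedding transports closures and interiors, and every neighbourhood of the unit
  contains one of those in \<open>dense_small_orbits\<close>.\<close>

lemma d_open_action_coordinates:
  "d_open_action K uniform_topology (subtopology compactum (coordinates ` topspace X)) permute"
proof -
  let ?E = "coordinates ` topspace X"
  let ?Y = "subtopology compactum ?E"
  have topY: "topspace ?Y = ?E"
    using coordinates_subset by auto
  have hom: "homeomorphic_map X ?Y coordinates"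
    using compactification_compactum by (simp add: compactification_def embedding_map_def)
  have E_closed: "permute g b \<in> ?E" if "g \<in> carrier K" "b \<in> ?E" for g b
    using that by (auto simp: permute_coordinates)
  have "continuous_map (prod_topology uniform_topology ?Y) ?Y (\<lambda>(g, b). permute g b)"
    unfolding prod_topology_subtopology continuous_map_in_subtopology
    using E_closed by (auto intro!: continuous_map_from_subtopology continuous_permute_action simp: topspace_uniform)
  moreover have "group_action K ?E (\<lambda>g. restrict (permute g) ?E)"
    using E_closed coordinates_subset
    by (intro group_action_restrictI is_group) (auto simp: permute_one permute_mult subset_iff)
  ultimately have "continuous_action K uniform_topology ?Y permute"
    unfolding continuous_action_def topY by simp
  moreover have "b \<in> ?Y interior_of (?Y closure_of ((\<lambda>g. permute g b) ` U))"
    if b: "b \<in> ?E" and U: "openin uniform_topology U" "\<one> \<in> U" for b U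
  proof -
    obtain x where x: "x \<in> topspace X" "b = coordinates x"
      using b by blast
    have UK: "U \<subseteq> carrier K"
      using openin_subset[OF U(1)] topspace_uniform by simp
    obtain I \<epsilon> where "finite I" "\<epsilon> > 0"
      and I: "{g \<in> carrier K. \<forall>i\<in>I. \<forall>y\<in>topspace X. \<bar>f i (\<alpha> g y) - f i y\<bar> \<le> \<epsilon>} \<subseteq> U"
      by (rule uniform_neighbourhood_base[OF U])
    have "x \<in> X interior_of (X closure_of ((\<lambda>g. \<alpha> g x) ` U))"
      using dense_small_orbits[OF \<open>finite I\<close> \<open>\<epsilon> > 0\<close> x(1)]
        interior_of_mono[OF closure_of_mono[OF image_mono[OF I]]] by (rule subsetD[rotated])
    then have "b \<in> coordinates ` (X interior_of (X closure_of ((\<lambda>g. \<alpha> g x) ` U)))"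
      using x(2) by blast
    also have "\<dots> = ?Y interior_of (coordinates ` (X closure_of ((\<lambda>g. \<alpha> g x) ` U)))"
      by (rule homeomorphic_map_interior_of[OF hom closure_of_subset_topspace, symmetric])
    also have "\<dots> = ?Y interior_of (?Y closure_of (coordinates ` ((\<lambda>g. \<alpha> g x) ` U)))"
      using UK x by (subst homeomorphic_map_closure_of[OF hom]) auto
    also have "coordinates ` ((\<lambda>g. \<alpha> g x) ` U) = (\<lambda>g. permute g b) ` U"
      unfolding image_image x(2) using UK x(1) by (intro image_cong) (auto simp: permute_coordinates)
    finally show ?thesis .
  qed
  ultimately show ?thesis
    unfolding d_open_action_def topY by simp
qed

end

section \<open>The countable group acting on the compactification\<close>

text \<open>The quotient of \<open>G\<close> by the kernel of the action, realised on natural numbers by coding the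
  maps \<open>\<alpha> g\<close>; \<open>\<delta>\<close> picks a representative of each class. Dividing by the kernel is what makes the
  topology of uniform convergence Hausdorff.\<close>

lemma (in group) faithful_nat_group:
  fixes \<alpha> :: "'a \<Rightarrow> 'x \<Rightarrow> 'x"
  assumes "countable (carrier G)"
    and closed: "\<And>g x. \<lbrakk>g \<in> carrier G; x \<in> E\<rbrakk> \<Longrightarrow> \<alpha> g x \<in> E"
    and mult: "\<And>g h x. \<lbrakk>g \<in> carrier G; h \<in> carrier G; x \<in> E\<rbrakk> \<Longrightarrow> \<alpha> (g \<otimes> h) x = \<alpha> g (\<alpha> h x)"
  obtains H :: "nat monoid" and \<delta> :: "nat \<Rightarrow> 'a" where
    "group H" "\<And>n. n \<in> carrier H \<Longrightarrow> \<delta> n \<in> carrier G"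
    "\<And>x. x \<in> E \<Longrightarrow> \<alpha> (\<delta> \<one>\<^bsub>H\<^esub>) x = \<alpha> \<one> x"
    "\<And>m n x. \<lbrakk>m \<in> carrier H; n \<in> carrier H; x \<in> E\<rbrakk> \<Longrightarrow> \<alpha> (\<delta> (m \<otimes>\<^bsub>H\<^esub> n)) x = \<alpha> (\<delta> m) (\<alpha> (\<delta> n) x)"
    "\<And>m n. \<lbrakk>m \<in> carrier H; n \<in> carrier H; \<And>x. x \<in> E \<Longrightarrow> \<alpha> (\<delta> m) x = \<alpha> (\<delta> n) x\<rbrakk> \<Longrightarrow> m = n"
    "\<And>g. g \<in> carrier G \<Longrightarrow> \<exists>n\<in>carrier H. \<forall>x\<in>E. \<alpha> (\<delta> n) x = \<alpha> g x"
proof -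
  define Q where "Q = (\<lambda>g. restrict (\<alpha> g) E) ` carrier G"
  define code where "code g = to_nat_on Q (restrict (\<alpha> g) E)" for g
  define \<delta> where "\<delta> = inv_into (carrier G) code"
  define H0 where "H0 = \<lparr>carrier = UNIV :: nat set, mult = \<lambda>m n. code (\<delta> m \<otimes> \<delta> n), one = code \<one>\<rparr>"
  define H where "H = H0\<lparr>carrier := code ` carrier G, one := code \<one>\<rparr>"
  have "countable Q"
    using assms(1) by (simp add: Q_def)
  have code_eq: "code g = code h \<longleftrightarrow> (\<forall>x\<in>E. \<alpha> g x = \<alpha> h x)" if "g \<in> carrier G" "h \<in> carrier G" for g h
  proof -
    have "restrict (\<alpha> g) E \<in> Q" "restrict (\<alpha> h) E \<in> Q"
      using that by (simp_all add: Q_def)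
    then have "code g = code h \<longleftrightarrow> restrict (\<alpha> g) E = restrict (\<alpha> h) E"
      unfolding code_def by (rule to_nat_on_inj[OF \<open>countable Q\<close>])
    also have "\<dots> \<longleftrightarrow> (\<forall>x\<in>E. \<alpha> g x = \<alpha> h x)"
      by (auto simp: fun_eq_iff restrict_def)
    finally show ?thesis .
  qed
  have \<delta>_carrier: "\<delta> n \<in> carrier G" and code_\<delta>: "code (\<delta> n) = n" if "n \<in> code ` carrier G" for n
    using that by (simp_all add: \<delta>_def inv_into_into f_inv_into_f)
  have \<delta>_code: "\<alpha> (\<delta> (code g)) x = \<alpha> g x" if "g \<in> carrier G" "x \<in> E" for g x
    using code_eq[of "\<delta> (code g)" g] code_\<delta>[of "code g"] \<delta>_carrier[of "code g"] that by simp
  have "code \<in> hom G H0"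
  proof (rule homI)
    fix g h assume gh: "g \<in> carrier G" "h \<in> carrier G"
    then have "\<delta> (code g) \<in> carrier G" "\<delta> (code h) \<in> carrier G"
      by (simp_all add: \<delta>_carrier)
    then show "code (g \<otimes> h) = code g \<otimes>\<^bsub>H0\<^esub> code h"
      using gh by (simp add: H0_def code_eq mult \<delta>_code closed)
  qed (simp add: H0_def)
  then have "group H"
    unfolding H_def by (rule hom_imp_img_group)
  have carrier_H: "carrier H = code ` carrier G"
    by (simp add: H_def)
  show thesis
  proof (rule that[of H \<delta>])
    show "group H" by fact
    show "\<delta> n \<in> carrier G" if "n \<in> carrier H" for n
      using that by (simp add: carrier_H \<delta>_carrier)
    show "\<alpha> (\<delta> \<one>\<^bsub>H\<^esub>) x = \<alpha> \<one> x" if "x \<in> E" for x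
      using that by (simp add: H_def \<delta>_code)
    show "\<alpha> (\<delta> (m \<otimes>\<^bsub>H\<^esub> n)) x = \<alpha> (\<delta> m) (\<alpha> (\<delta> n) x)" if "m \<in> carrier H" "n \<in> carrier H" "x \<in> E" for m n x
      using that by (simp add: carrier_H) (simp add: H_def H0_def \<delta>_code \<delta>_carrier mult)
    show "m = n" if "m \<in> carrier H" "n \<in> carrier H" "\<And>x. x \<in> E \<Longrightarrow> \<alpha> (\<delta> m) x = \<alpha> (\<delta> n) x" for m n
      using that code_\<delta> code_eq[of "\<delta> m" "\<delta> n"] by (simp add: carrier_H \<delta>_carrier)
    show "\<exists>n\<in>carrier H. \<forall>x\<in>E. \<alpha> (\<delta> n) x = \<alpha> g x" if "g \<in> carrier G" for g
      using that by (auto simp: carrier_H \<delta>_code)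
  qed
qed

text \<open>The coordinates enumerate all composites of the separating functions with elements of the
  countable subgroup, so that this set of coordinates is invariant under composition with the
  subgroup.\<close>

lemma (in d_open_transformation_group) countable_coordinate_action:
  assumes X: "second_countable X" "metrizable_space X" and S: "countable S" "S \<subseteq> carrier G"
  obtains H :: "nat monoid" and \<delta> :: "nat \<Rightarrow> 'a" and f :: "nat \<Rightarrow> 'x \<Rightarrow> real" and \<sigma> where
    "coordinate_action H X (\<lambda>n. \<alpha> (\<delta> n)) f \<sigma>"
    "\<And>s. s \<in> S \<Longrightarrow> \<exists>n\<in>carrier H. \<forall>x\<in>topspace X. \<alpha> (\<delta> n) x = \<alpha> s x"
proof -
  obtain F0 where F0: "countable F0" "\<And>f. f \<in> F0 \<Longrightarrow> action_uniform f"
    and sep0: "\<And>U x. \<lbrakk>openin X U; x \<in> U\<rbrakk> \<Longrightarrow> \<exists>f\<in>F0. f x < 1/2 \<and> (\<forall>y\<in>topspace X - U. f y = 1)"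
    using countable_action_uniform_family[OF X(1) metrizable_imp_regular_space[OF X(2)]] by metis
  \<comment> \<open>The zero function keeps \<open>F\<close> nonempty, so that it can be enumerated, when \<open>X\<close> is empty.\<close>
  define F where "F = insert (\<lambda>_. 0) F0"
  have "action_uniform (\<lambda>_. 0)"
    unfolding action_uniform_def using openin_topspace[of T] topspace_eq_carrier by fastforce
  then have F: "countable F" "\<And>f. f \<in> F \<Longrightarrow> action_uniform f"
    using F0 by (auto simp: F_def)
  obtain A where A: "subgroup A G" "countable A" "S \<subseteq> A"
    and dense: "\<And>K \<epsilon> x. \<lbrakk>finite K; K \<subseteq> translates F A; \<epsilon> > 0; x \<in> topspace X\<rbrakk>
      \<Longrightarrow> x \<in> X interior_of (X closure_of ((\<lambda>g. \<alpha> g x) ` (A \<inter> nearly_fixing K \<epsilon>)))"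
    using countable_d_open_subgroup[OF X(1) F S] by metis
  have AG: "A \<subseteq> carrier G"
    using A(1) by (rule subgroup.subset)
  interpret A: group "G\<lparr>carrier := A\<rparr>"
    using A(1) by (rule subgroup.subgroup_is_group[OF _ is_group])
  have A_closed: "\<alpha> g x \<in> topspace X" if "g \<in> A" "x \<in> topspace X" for g x
    using that AG by blast
  have A_mult: "\<alpha> (g \<otimes> h) x = \<alpha> g (\<alpha> h x)" if "g \<in> A" "h \<in> A" "x \<in> topspace X" for g h x
    using act_mult[OF subsetD[OF AG that(1)] subsetD[OF AG that(2)] that(3)] .
  obtain H :: "nat monoid" and \<delta> :: "nat \<Rightarrow> 'a" where H: "group H" "\<And>n. n \<in> carrier H \<Longrightarrow> \<delta> n \<in> A"
    and \<delta>_one: "\<And>x. x \<in> topspace X \<Longrightarrow> \<alpha> (\<delta> \<one>\<^bsub>H\<^esub>) x = x"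
    and \<delta>_mult: "\<And>m n x. \<lbrakk>m \<in> carrier H; n \<in> carrier H; x \<in> topspace X\<rbrakk> \<Longrightarrow>
      \<alpha> (\<delta> (m \<otimes>\<^bsub>H\<^esub> n)) x = \<alpha> (\<delta> m) (\<alpha> (\<delta> n) x)"
    and faithful: "\<And>m n. \<lbrakk>m \<in> carrier H; n \<in> carrier H; \<And>x. x \<in> topspace X \<Longrightarrow> \<alpha> (\<delta> m) x = \<alpha> (\<delta> n) x\<rbrakk> \<Longrightarrow> m = n"
    and \<delta>_onto: "\<And>g. g \<in> A \<Longrightarrow> \<exists>n\<in>carrier H. \<forall>x\<in>topspace X. \<alpha> (\<delta> n) x = \<alpha> g x"
  proof (rule A.faithful_nat_group[of "topspace X" \<alpha>], goal_cases)
    case (4 H \<delta>)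
    show ?case
      by (rule 4(1)[of H \<delta>]) (use 4 in auto)
  qed (use A(2) in \<open>simp_all add: A_closed A_mult\<close>)
  define f where "f = from_nat_into (translates F A)"
  have countable_F: "countable (translates F A)" and nonempty: "translates F A \<noteq> {}"
    using F(1) A(2) subgroup.one_closed[OF A(1)] by (auto simp: translates_def F_def)
  have range_f: "range f = translates F A"
    unfolding f_def using nonempty countable_F by (rule range_from_nat_into)
  have f_in: "f i \<in> translates F A" for i
    using range_f by blast
  have f_uniform: "action_uniform (f i)" for i
    using f_in[of i] F(2) AG unfolding translates_def by (auto intro!: action_uniform_translate)
  have "\<exists>j. \<forall>x\<in>topspace X. f j x = f i (\<alpha> (\<delta> n) x)" if n: "n \<in> carrier H" for n i
  proof -
    obtain k h where k: "k \<in> F" "h \<in> A" "f i = (\<lambda>x. k (\<alpha> h x))"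
      using f_in[of i] by (auto simp: translates_def)
    have "(\<lambda>x. k (\<alpha> (h \<otimes> \<delta> n) x)) \<in> translates F A"
      using k subgroup.m_closed[OF A(1) k(2) H(2)[OF n]] by (auto simp: translates_def)
    then obtain j where "f j = (\<lambda>x. k (\<alpha> (h \<otimes> \<delta> n) x))"
      using range_f by (metis rangeE)
    then show ?thesis
      using k H(2)[OF n] AG by (intro exI[of _ j]) (auto simp: act_mult subset_iff)
  qed
  then obtain \<sigma> where \<sigma>: "\<And>n i x. \<lbrakk>n \<in> carrier H; x \<in> topspace X\<rbrakk> \<Longrightarrow> f (\<sigma> n i) x = f i (\<alpha> (\<delta> n) x)"
    by metis
  have "coordinate_action H X (\<lambda>n. \<alpha> (\<delta> n)) f \<sigma>"
  proof (intro coordinate_action.intro H(1) coordinate_action_axioms.intro)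
    show "Hausdorff_space X"
      by (rule metrizable_imp_Hausdorff_space[OF X(2)])
    show "\<alpha> (\<delta> n) x \<in> topspace X" if "n \<in> carrier H" "x \<in> topspace X" for n x
      using that H(2) AG by auto
    show "continuous_map X euclideanreal (f i)" "x \<in> topspace X \<Longrightarrow> f i x \<in> {0..1}" for i x
      using f_uniform[of i] unfolding action_uniform_def by blast+
    show "\<exists>i. f i x < 1/2 \<and> (\<forall>y\<in>topspace X - U. f i y = 1)" if U: "openin X U" "x \<in> U" for U x
    proof -
      obtain k where k: "k \<in> F0" "k x < 1/2" "\<forall>y\<in>topspace X - U. k y = 1"
        using sep0[OF U] by blast
      have "(\<lambda>x. k (\<alpha> \<one> x)) \<in> translates F A"
        using k(1) subgroup.one_closed[OF A(1)] by (auto simp: translates_def F_def)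
      then obtain i where "f i = (\<lambda>x. k (\<alpha> \<one> x))"
        using range_f by (metis rangeE)
      then show ?thesis
        using k U openin_subset[OF U(1)] by (intro exI[of _ i]) auto
    qed
    fix I :: "nat set" and \<epsilon> :: real and x
    assume I: "finite I" "\<epsilon> > 0" and x: "x \<in> topspace X"
    let ?B = "{n \<in> carrier H. \<forall>i\<in>I. \<forall>y\<in>topspace X. \<bar>f i (\<alpha> (\<delta> n) y) - f i y\<bar> \<le> \<epsilon>}"
    have "(\<lambda>g. \<alpha> g x) ` (A \<inter> nearly_fixing (f ` I) \<epsilon>) \<subseteq> (\<lambda>n. \<alpha> (\<delta> n) x) ` ?B"
    proof clarify
      fix g assume g: "g \<in> A" "g \<in> nearly_fixing (f ` I) \<epsilon>"
      then obtain n where "n \<in> carrier H" "\<forall>x\<in>topspace X. \<alpha> (\<delta> n) x = \<alpha> g x"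
        using \<delta>_onto by blast
      with g x show "\<alpha> g x \<in> (\<lambda>n. \<alpha> (\<delta> n) x) ` ?B"
        by (intro image_eqI[of _ _ n]) (auto simp: nearly_fixing_def)
    qed
    moreover have "x \<in> X interior_of (X closure_of ((\<lambda>g. \<alpha> g x) ` (A \<inter> nearly_fixing (f ` I) \<epsilon>)))"
      using I x f_in by (intro dense) auto
    ultimately show "x \<in> X interior_of (X closure_of ((\<lambda>n. \<alpha> (\<delta> n) x) ` ?B))"
      by (meson closure_of_mono interior_of_mono subsetD)
  qed (use \<delta>_one \<delta>_mult faithful \<sigma> in auto)
  then show thesis
    using that[of H \<delta> f \<sigma>] \<delta>_onto A(3) by blast
qed

theorem corollary5p18:
  fixes G :: "('g, 'm) monoid_scheme" and TG :: "'g topology"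
    and X :: "'x topology" and \<alpha> :: "'g \<Rightarrow> 'x \<Rightarrow> 'x" and S :: "'g set"
  assumes "topological_group G TG" and "tychonoff_space TG"
    and "separable_space X" and "metrizable_space X"
    and "d_open_action G TG X \<alpha>"
    and "S \<subseteq> carrier G" and "countable S"
  shows "\<exists>(H :: nat monoid) (TH :: nat topology)
           (B :: (nat \<Rightarrow> real) topology) (e :: 'x \<Rightarrow> nat \<Rightarrow> real)
           (\<gamma> :: nat \<Rightarrow> (nat \<Rightarrow> real) \<Rightarrow> (nat \<Rightarrow> real)).
           topological_group H TH \<and> countable (carrier H) \<and> metrizable_space TH \<and>
           compactification X e B \<and> metrizable_space B \<and>
           continuous_action H TH B \<gamma> \<and>
           (\<forall>h \<in> carrier H. \<gamma> h ` (e ` topspace X) \<subseteq> e ` topspace X) \<and>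
           d_open_action H TH (subtopology B (e ` topspace X)) \<gamma> \<and>
           (\<forall>s \<in> S. \<exists>h \<in> carrier H. \<forall>x \<in> topspace X. e (\<alpha> s x) = \<gamma> h (e x))"
proof -
  interpret G: d_open_transformation_group G TG X \<alpha>
    using assms by (simp add: d_open_transformation_group_def d_open_transformation_group_axioms_def)
  have "second_countable X"
    using assms(3,4) by (rule separable_metrizable_imp_second_countable)
  then obtain H :: "nat monoid" and \<delta> :: "nat \<Rightarrow> 'g" and f :: "nat \<Rightarrow> 'x \<Rightarrow> real" and \<sigma>
    where "coordinate_action H X (\<lambda>n. \<alpha> (\<delta> n)) f \<sigma>"
      and S: "\<And>s. s \<in> S \<Longrightarrow> \<exists>n\<in>carrier H. \<forall>x\<in>topspace X. \<alpha> (\<delta> n) x = \<alpha> s x"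
    using G.countable_coordinate_action[OF _ assms(4,7,6)] by metis
  then interpret H: coordinate_action H X "\<lambda>n. \<alpha> (\<delta> n)" f \<sigma>
    by simp
  show ?thesis
  proof (intro exI[of _ H] exI[of _ H.uniform_topology] exI[of _ H.compactum] exI[of _ H.coordinates]
      exI[of _ H.permute] conjI)
    show "\<forall>h\<in>carrier H. H.permute h ` H.coordinates ` topspace X \<subseteq> H.coordinates ` topspace X"
      by (auto simp: H.permute_coordinates)
    show "\<forall>s\<in>S. \<exists>h\<in>carrier H. \<forall>x\<in>topspace X. H.coordinates (\<alpha> s x) = H.permute h (H.coordinates x)"
      using S by (metis H.permute_coordinates)
  qed (use H.topological_group_uniform H.metrizable_uniform H.compactification_compactum
      H.metrizable_compactum H.continuous_action_compactum H.d_open_action_coordinates in auto)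
qed

end
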